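(* For every integer $r\ge 3$ there are infinitely many irrational numbers in $[0,1)$ that are non-jumps for $r$.
   Context: An $r$-uniform graph $G$ is a finite set $V(G)$ of vertices together with a set $E(G)\subseteq\binom{V(G)}{r}$ of edges, where $\binom{V}{r}$ denotes the family of all $r$-subsets of $V$. Its density is $d(G)=|E(G)|/\binom{|V(G)|}{r}$. A real number $\alpha\in[0,1)$ is a jump for an integer $r\ge 2$ if there exists a constant $c>0$ such that for any $\epsilon>0$ and any integer $m\ge r$ there exists an integer $n_0(\epsilon,m)$ such that any $r$-uniform graph with $n>n_0(\epsilon,m)$ vertices and density $\ge\alpha+\epsilon$ contains a subgraph with $m$ vertices and density $\ge\alpha+c$. A number in $[0,1)$ that is not a jump for $r$ is called a non-jump for $r$. *)

theory Defs
  imports Complex_Main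
begin

definition uniform_graph :: "nat \<Rightarrow> 'a set \<Rightarrow> 'a set set \<Rightarrow> bool" where
  "uniform_graph r V E \<longleftrightarrow> finite V \<and> E \<subseteq> {e. e \<subseteq> V \<and> card e = r}"

(* For card V < r the quotient is 0 by the convention x / 0 = 0; no such graph can meet a
   density bound that is positive, so this convention is immaterial for jumps. *)
definition density :: "nat \<Rightarrow> 'a set \<Rightarrow> 'a set set \<Rightarrow> real" where
  "density r V E = real (card E) / real (card V choose r)"

(* Subgraphs need not be induced. *)
definition uniform_subgraph ::
    "nat \<Rightarrow> 'a set \<Rightarrow> 'a set set \<Rightarrow> 'a set \<Rightarrow> 'a set set \<Rightarrow> bool" where
  "uniform_subgraph r W F V E \<longleftrightarrow> uniform_graph r W F \<and> W \<subseteq> V \<and> F \<subseteq> E"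

(* Graphs are finite, so taking the vertices from nat covers all of them up to isomorphism. *)
definition jump :: "nat \<Rightarrow> real \<Rightarrow> bool" where
  "jump r \<alpha> \<longleftrightarrow> 0 \<le> \<alpha> \<and> \<alpha> < 1 \<and>
     (\<exists>c>0. \<forall>\<epsilon>>0. \<forall>m\<ge>r. \<exists>n\<^sub>0. \<forall>(V :: nat set) E.
        uniform_graph r V E \<and> card V > n\<^sub>0 \<and> density r V E \<ge> \<alpha> + \<epsilon> \<longrightarrow>
        (\<exists>W F. uniform_subgraph r W F V E \<and> card W = m \<and> density r W F \<ge> \<alpha> + c))"

definition non_jump :: "nat \<Rightarrow> real \<Rightarrow> bool" where
  "non_jump r \<alpha> \<longleftrightarrow> 0 \<le> \<alpha> \<and> \<alpha> < 1 \<and> \<not> jump r \<alpha>"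

end

theory Submission
  imports Defs "HOL-Library.FuncSet" "HOL-Library.Nat_Bijection"
begin

text \<open>
  The proof follows the method of Frankl and Roedl.  Give the vertices of an \<open>r\<close>-graph \<open>P\<close> weights
  \<open>w\<close> and let \<open>P(w)\<close> be the sum over the edges of the products of the weights.  The blow-ups of \<open>P\<close>
  (vertex \<open>v\<close> replaced by about \<open>n w(v)\<close> copies) are arbitrarily large graphs of density at least
  \<open>r! P(w) / (\<Sum>w)^r\<close>, while a set of \<open>m\<close> vertices of a blow-up meets at most \<open>m\<close> classes and so
  sees only weights on \<open>P\<close> with support of size at most \<open>m\<close>.  Hence \<open>\<alpha>\<close> is a non-jump as soon as for
  every \<open>m\<close> there is a pattern \<open>P\<close> whose density \<open>r! P(w) / (\<Sum>w)^r\<close> exceeds \<open>\<alpha>\<close> for some \<open>w\<close> but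
  not for any \<open>w\<close> with at most \<open>m\<close> non-zero weights (\<open>lagrangian_gap\<close>,
  \<open>lagrangian_gap_imp_non_jump\<close>).

  For \<open>r = 3\<close> the patterns live on a disjoint union \<open>A \<union> C\<close>.  All triples that meet both parts are
  edges; \<open>C\<close> carries a complete \<open>k\<close>-partite 3-graph; \<open>A\<close> carries a triple system \<open>F\<close>.  In the limit
  in which \<open>F\<close> is negligible, the non-edges have density \<open>a^3 + \<theta>^2 c^3\<close> where \<open>a + c = 1\<close> are the
  weights of the two parts and \<open>\<theta>^2 = (3k - 2) / k^2\<close> is the density of the triples missing in \<open>C\<close>.
  Its minimum is \<open>(\<theta> / (1 + \<theta>))^2\<close>, attained at \<open>a = \<theta> c\<close>, and
  \<open>\<alpha> = 1 - (\<theta> / (1 + \<theta>))^2\<close>.  A pattern with \<open>t\<close> vertices in \<open>A\<close> falls short of \<open>\<alpha>\<close> by a term of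
  order \<open>t^2\<close> out of \<open>t^3\<close>, because two copies of the same vertex lie in no common edge.
  So \<open>F\<close> with \<open>D t^2\<close> edges, \<open>D\<close> a large constant, pushes the density above \<open>\<alpha>\<close>.  On the other hand
  \<open>F\<close> can be chosen so that every set of \<open>s \<le> m\<close> vertices spans fewer than \<open>s\<close> of its edges: this is
  the deletion method (\<open>ex_sparse_triple_system\<close>).  If the weights live on at most \<open>m\<close> vertices, such
  an \<open>F\<close> contributes at most \<open>M^2 (a - M)\<close> where \<open>M\<close> is the largest weight in \<open>A\<close>, and this is
  outweighed by the loss from repeated vertices, which is at least of order \<open>c M^2\<close>
  (\<open>local_deficit\<close>, \<open>lagrangian_gap_3\<close>).

  Taking \<open>k = 3 i^2 + 1\<close> makes \<open>3k - 2 = (3i)^2 + 1\<close> a non-square, so \<open>\<theta>\<close> and with it \<open>\<alpha>\<close> are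
  irrational, and different \<open>i\<close> give different \<open>\<alpha>\<close>.  Finally, adding one new vertex to all edges of a
  pattern leads from \<open>r\<close> to \<open>r + 1\<close> and multiplies \<open>\<alpha>\<close> by the rational number
  \<open>(r / (r + 1))^r\<close> (\<open>lagrangian_gap_Suc\<close>), so infinitely many irrational values survive for every
  \<open>r \<ge> 3\<close>.
\<close>

section \<open>Edge polynomials and blow-ups\<close>

definition edge_poly :: "'a set set \<Rightarrow> ('a \<Rightarrow> real) \<Rightarrow> real" where
  "edge_poly E x = (\<Sum>e\<in>E. \<Prod>v\<in>e. x v)"

lemma card_eq_edge_poly: "real (card E) = edge_poly E (\<lambda>_. 1)"
  by (simp add: edge_poly_def)

lemma edge_poly_split:
  assumes "finite E" "F \<subseteq> E"
  shows "edge_poly E y = edge_poly F y + edge_poly (E - F) y"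
  using assms by (simp add: edge_poly_def sum.subset_diff)

lemma edge_poly_insert_vertex:
  assumes "\<And>e. e \<in> E \<Longrightarrow> finite e" "\<And>e. e \<in> E \<Longrightarrow> z \<notin> e"
  shows "edge_poly (insert z ` E) y = y z * edge_poly E y"
proof -
  have "inj_on (insert z) E" using assms(2) by (metis inj_onI insert_ident)
  thus ?thesis using assms
    by (auto simp: edge_poly_def sum.reindex sum_distrib_left intro!: sum.cong)
qed

text \<open>
  A set \<open>X\<close> with \<open>\<tau> ` X = e\<close> and as many elements as \<open>e\<close> picks one element from each fibre
  over \<open>e\<close>; expanding the product of the fibre sums runs over exactly these choices.
\<close>
lemma transversal_sum:
  assumes "finite W" "finite e"
  shows "(\<Sum>X | X \<subseteq> W \<and> card X = card e \<and> \<tau> ` X = e. \<Prod>x\<in>X. y x) =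
         (\<Prod>v\<in>e. \<Sum>x | x \<in> W \<and> \<tau> x = v. (y x :: real))"
proof -
  define B where "B v = {x \<in> W. \<tau> x = v}" for v
  have inj: "inj_on \<tau> X" if "X \<subseteq> W" "card X = card e" "\<tau> ` X = e" for X
    using that assms by (metis eq_card_imp_inj_on finite_subset)
  have "(\<Prod>v\<in>e. \<Sum>x | x \<in> W \<and> \<tau> x = v. y x) = (\<Sum>g\<in>Pi\<^sub>E e B. \<Prod>v\<in>e. y (g v))"
    using assms unfolding B_def by (subst prod_sum_PiE) auto
  also have "\<dots> = (\<Sum>X | X \<subseteq> W \<and> card X = card e \<and> \<tau> ` X = e. \<Prod>x\<in>X. y x)"
  proof (rule sum.reindex_bij_witness[where i = "\<lambda>X. restrict (the_inv_into X \<tau>) e"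
        and j = "\<lambda>g. g ` e"], goal_cases)
    case (1 g)
    hence g: "g v \<in> W" "\<tau> (g v) = v" if "v \<in> e" for v using that by (auto simp: B_def)
    have "inj_on \<tau> (g ` e)" using g by (auto simp: inj_on_def)
    hence "the_inv_into (g ` e) \<tau> v = g v" if "v \<in> e" for v
      using g that by (metis imageI the_inv_into_f_f)
    thus ?case using 1 by (intro ext) (auto simp: restrict_def PiE_def extensional_def)
  next
    case (2 g)
    hence g: "g v \<in> W" "\<tau> (g v) = v" if "v \<in> e" for v using that by (auto simp: B_def)
    have "inj_on g e" using g by (metis inj_on_inverseI)
    thus ?case using g by (auto simp: card_image image_image)
  next
    case (3 X)
    with inj[of X] show ?case
      by (auto simp: the_inv_into_f_f image_iff)
  next
    case (4 X)
    with inj[of X] show ?case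
      by (auto simp: B_def the_inv_into_f_f)
  next
    case (5 g)
    hence g: "g v \<in> W" "\<tau> (g v) = v" if "v \<in> e" for v using that by (auto simp: B_def)
    have "inj_on g e" using g by (metis inj_on_inverseI)
    thus ?case by (simp add: prod.reindex)
  qed
  finally show ?thesis by simp
qed

text \<open>
  Used twice: with \<open>y = 1\<close> it counts the edges that a set \<open>W\<close> of vertices of a blow-up spans, and with
  general \<open>y\<close> it reduces the \<open>k\<close>-partite triples in \<open>C\<close> to the complete 3-graph on the \<open>k\<close> classes.
\<close>
lemma edge_poly_blow_up:
  assumes "finite W" "finite E" "\<And>e. e \<in> E \<Longrightarrow> finite e \<and> card e = r"
  shows "edge_poly {X. X \<subseteq> W \<and> card X = r \<and> \<tau> ` X \<in> E} y =
         edge_poly E (\<lambda>v. \<Sum>x | x \<in> W \<and> \<tau> x = v. y x)"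
proof -
  have "edge_poly {X. X \<subseteq> W \<and> card X = r \<and> \<tau> ` X \<in> E} y =
      (\<Sum>e\<in>E. \<Sum>X | X \<in> {X. X \<subseteq> W \<and> card X = r \<and> \<tau> ` X \<in> E} \<and> \<tau> ` X = e. \<Prod>x\<in>X. y x)"
    unfolding edge_poly_def using assms(1,2) by (subst sum.group) auto
  also have "\<dots> = (\<Sum>e\<in>E. \<Sum>X | X \<subseteq> W \<and> card X = card e \<and> \<tau> ` X = e. \<Prod>x\<in>X. y x)"
    using assms(3) by (intro sum.cong) auto
  also have "\<dots> = edge_poly E (\<lambda>v. \<Sum>x | x \<in> W \<and> \<tau> x = v. y x)"
    unfolding edge_poly_def using assms by (intro sum.cong transversal_sum) auto
  finally show ?thesis .
qed

section \<open>A criterion for non-jumps\<close>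

text \<open>
  Writing \<open>\<lambda>(P)\<close> for the Lagrangian of \<open>P\<close>, the maximum of its edge polynomial over the simplex, the
  definition says that some patterns have \<open>r! \<lambda>(P) > \<alpha>\<close> while all their subgraphs with \<open>m\<close> vertices
  have \<open>r! \<lambda> \<le> \<alpha>\<close>.  The global weights are natural numbers because they become class sizes.
\<close>
definition lagrangian_gap :: "nat \<Rightarrow> real \<Rightarrow> bool" where
  "lagrangian_gap r \<alpha> \<longleftrightarrow> (\<forall>m. \<exists>(V :: nat set) E. uniform_graph r V E \<and>
     (\<exists>w :: nat \<Rightarrow> nat. fact r * edge_poly E (\<lambda>v. real (w v)) > \<alpha> * (\<Sum>v\<in>V. real (w v)) ^ r) \<and>
     (\<forall>y. (\<forall>v\<in>V. 0 \<le> y v) \<longrightarrow> card {v \<in> V. y v \<noteq> 0} \<le> m \<longrightarrow>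
        fact r * edge_poly E y \<le> \<alpha> * (\<Sum>v\<in>V. y v) ^ r))"

lemma gap_weights_pos:
  fixes w :: "nat \<Rightarrow> nat"
  assumes "uniform_graph r V E" "1 \<le> r" "0 \<le> \<alpha>"
    and "\<alpha> * (\<Sum>v\<in>V. real (w v)) ^ r < fact r * edge_poly E (\<lambda>v. real (w v))"
  shows "0 < (\<Sum>v\<in>V. w v)"
proof (rule ccontr)
  assume "\<not> ?thesis"
  hence z: "w v = 0" if "v \<in> V" for v
    using that assms(1) by (auto simp: uniform_graph_def)
  have "(\<Prod>v\<in>e. real (w v)) = 0" if e: "e \<in> E" for e
  proof -
    have e': "e \<subseteq> V" "card e = r" "finite e"
      using e assms(1) by (auto simp: uniform_graph_def intro: finite_subset)
    then obtain v where "v \<in> e" using assms(2) by fastforce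
    thus ?thesis using e' z by (auto simp: prod_zero_iff)
  qed
  hence "edge_poly E (\<lambda>v. real (w v)) = 0" by (simp add: edge_poly_def)
  moreover have "0 \<le> \<alpha> * (\<Sum>v\<in>V. real (w v)) ^ r"
    using assms(3) by (intro mult_nonneg_nonneg zero_le_power sum_nonneg) auto
  ultimately show False using assms(4) by simp
qed

lemma falling_power_le: "r \<le> m \<Longrightarrow> (real m - real r) ^ r \<le> fact r * real (m choose r)"
proof -
  assume "r \<le> m"
  have "fact r * real (m choose r) = (\<Prod>i=0..<r. real m - real i)"
    by (simp add: binomial_gbinomial gbinomial_prod_rev)
  also have "\<dots> \<ge> (\<Prod>i=0..<r. real m - real r)"
    using \<open>r \<le> m\<close> by (intro prod_mono) auto
  finally show ?thesis by simp
qed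

text \<open>
  The edge polynomial bounds the edges among \<open>m\<close> vertices by \<open>\<alpha> m^r / r!\<close> rather than by
  \<open>\<alpha> (m choose r)\<close>; for large \<open>m\<close> the difference is absorbed by \<open>c\<close>.
\<close>
lemma power_less_falling:
  assumes "0 \<le> \<alpha>" "0 < c"
  shows "\<exists>m\<ge>r. \<alpha> * real m ^ r < (\<alpha> + c) * (fact r * real (m choose r))"
proof -
  have "((\<lambda>m. 1 - real r / real m) \<longlonglongrightarrow> 1 - 0)"
    by (intro tendsto_diff tendsto_const lim_const_over_n)
  hence "((\<lambda>m. (1 - real r / real m) ^ r) \<longlonglongrightarrow> (1 - 0) ^ r)"
    by (rule tendsto_power)
  moreover have "\<alpha> / (\<alpha> + c) < (1 - 0) ^ r" using assms by simp
  ultimately have "\<forall>\<^sub>F m in sequentially. \<alpha> / (\<alpha> + c) < (1 - real r / real m) ^ r"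
    by (rule order_tendstoD(1))
  hence "\<forall>\<^sub>F m in sequentially. \<alpha> / (\<alpha> + c) < (1 - real r / real m) ^ r \<and> m \<ge> Suc r"
    using eventually_ge_at_top by (rule eventually_conj)
  then obtain m where m: "\<alpha> / (\<alpha> + c) < (1 - real r / real m) ^ r" "m \<ge> Suc r"
    by (metis (mono_tags, lifting) eventually_happens' sequentially_bot)
  have "(1 - real r / real m) * real m = real m - real r" using m by (simp add: field_simps)
  hence pw: "(1 - real r / real m) ^ r * real m ^ r = (real m - real r) ^ r"
    by (metis power_mult_distrib)
  have "\<alpha> < (\<alpha> + c) * (1 - real r / real m) ^ r"
    using m assms by (simp add: field_simps)
  hence "\<alpha> * real m ^ r < (\<alpha> + c) * (1 - real r / real m) ^ r * real m ^ r"
    using m by (intro mult_strict_right_mono) auto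
  also have "\<dots> = (\<alpha> + c) * (real m - real r) ^ r" using pw by (simp add: mult.assoc)
  also have "\<dots> \<le> (\<alpha> + c) * (fact r * real (m choose r))"
    using falling_power_le[of r m] m assms by (intro mult_left_mono) auto
  finally show ?thesis using m by (intro exI[of _ m]) auto
qed

lemma lagrangian_gap_imp_non_jump:
  assumes "lagrangian_gap r \<alpha>" "0 \<le> \<alpha>" "\<alpha> < 1" "r \<ge> 1"
  shows "non_jump r \<alpha>"
proof -
  have "\<not> jump r \<alpha>"
  proof
    assume "jump r \<alpha>"
    then obtain c where c: "c > 0" and J: "\<And>\<epsilon> m. \<epsilon> > 0 \<Longrightarrow> m \<ge> r \<Longrightarrow> \<exists>n\<^sub>0. \<forall>(V :: nat set) E.
        uniform_graph r V E \<and> card V > n\<^sub>0 \<and> density r V E \<ge> \<alpha> + \<epsilon> \<longrightarrow>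
        (\<exists>W F. uniform_subgraph r W F V E \<and> card W = m \<and> density r W F \<ge> \<alpha> + c)"
      unfolding jump_def by blast
    obtain m where m: "m \<ge> r" "\<alpha> * real m ^ r < (\<alpha> + c) * (fact r * real (m choose r))"
      using power_less_falling[OF assms(2) c] by blast
    obtain V :: "nat set" and E w where G: "uniform_graph r V E"
      and w: "fact r * edge_poly E (\<lambda>v. real (w v)) > \<alpha> * (\<Sum>v\<in>V. real (w v)) ^ r"
      and loc: "\<And>y. (\<forall>v\<in>V. 0 \<le> y v) \<Longrightarrow> card {v \<in> V. y v \<noteq> 0} \<le> m \<Longrightarrow>
        fact r * edge_poly E y \<le> \<alpha> * (\<Sum>v\<in>V. y v) ^ r"
      using assms(1) unfolding lagrangian_gap_def by meson
    have finV: "finite V" and EV: "\<And>e. e \<in> E \<Longrightarrow> e \<subseteq> V \<and> card e = r"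
      using G by (auto simp: uniform_graph_def)
    have finE: "finite E" using EV finV by (metis Pow_iff finite_Pow_iff finite_subset subsetI)
    have fe: "finite e \<and> card e = r" if "e \<in> E" for e
      using EV[OF that] finV finite_subset by blast
    define s where "s = (\<Sum>v\<in>V. w v)"
    have s0: "s > 0" unfolding s_def using G assms(4,2) w by (rule gap_weights_pos)
    define p where "p = fact r * edge_poly E (\<lambda>v. real (w v))"
    define \<epsilon> where "\<epsilon> = p / real s ^ r - \<alpha>"
    have "p > \<alpha> * real s ^ r" using w by (simp add: p_def s_def)
    hence "\<epsilon> > 0" using s0 by (simp add: \<epsilon>_def field_simps)
    then obtain n0 where n0: "\<And>(V :: nat set) E.
        uniform_graph r V E \<and> card V > n0 \<and> density r V E \<ge> \<alpha> + \<epsilon> \<Longrightarrow>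
        (\<exists>W F. uniform_subgraph r W F V E \<and> card W = m \<and> density r W F \<ge> \<alpha> + c)"
      using J[OF _ m(1), of \<epsilon>] by meson
    \<comment> \<open>Blowing up by \<open>n\<close> does not change the density bound, so any \<open>n\<close> that makes the graph
      large enough will do.\<close>
    define n where "n = Suc n0 + r"
    define \<tau> where "\<tau> = (\<lambda>x. fst (prod_decode x))"
    define fib where "fib v = (\<lambda>j. prod_encode (v, j)) ` {..<n * w v}" for v
    define VB where "VB = (\<Union>v\<in>V. fib v)"
    define EB where "EB = (\<lambda>W. {X. X \<subseteq> W \<and> card X = r \<and> \<tau> ` X \<in> E})"
    have finVB: "finite VB" using finV by (auto simp: VB_def fib_def)
    have \<tau>VB: "\<tau> ` VB \<subseteq> V" by (auto simp: \<tau>_def VB_def fib_def)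
    have fib_eq: "{x \<in> VB. \<tau> x = v} = fib v" if "v \<in> V" for v
      using that by (auto simp: VB_def fib_def \<tau>_def)
    have cfib: "card (fib v) = n * w v" for v
      unfolding fib_def by (subst card_image) (auto simp: inj_on_def)
    have cardW: "(\<Sum>v\<in>V. card {x \<in> W. \<tau> x = v}) = card W" if "W \<subseteq> VB" for W
    proof -
      have "finite W" "\<tau> ` W \<subseteq> V" using that finVB \<tau>VB finite_subset by blast+
      thus ?thesis using sum.group[of W V \<tau> "\<lambda>_. 1::nat"] finV by simp
    qed
    have cVB: "card VB = n * s"
      using cardW[of VB] by (simp add: fib_eq cfib s_def sum_distrib_left)
    have cEB: "real (card (EB W)) = edge_poly E (\<lambda>v. real (card {x \<in> W. \<tau> x = v}))"
      if "W \<subseteq> VB" for W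
    proof -
      have "finite W" using that finVB finite_subset by blast
      thus ?thesis unfolding card_eq_edge_poly EB_def
        by (subst edge_poly_blow_up) (use finE fe in auto)
    qed
    have UG: "uniform_graph r VB (EB VB)"
      using finVB by (auto simp: uniform_graph_def EB_def)
    have "n * 1 \<le> n * s" using s0 by (intro mult_le_mono) auto
    hence ns: "n0 < n * s" and nr: "r \<le> n * s" by (simp_all add: n_def)
    have "edge_poly E (\<lambda>v. real (card {x \<in> VB. \<tau> x = v})) =
        edge_poly E (\<lambda>v. real n * real (w v))"
      unfolding edge_poly_def
      by (intro sum.cong prod.cong refl, subst fib_eq) (use EV cfib in auto)
    also have "\<dots> = real n ^ r * edge_poly E (\<lambda>v. real (w v))"
      using fe by (simp add: edge_poly_def prod.distrib sum_distrib_left)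
    finally have cE: "fact r * real (card (EB VB)) = real n ^ r * p"
      using cEB[of VB] by (simp add: p_def)
    have p0: "p \<ge> 0"
      by (auto simp: p_def edge_poly_def intro!: sum_nonneg prod_nonneg mult_nonneg_nonneg)
    have chle: "fact r * real (n * s choose r) \<le> (real n * real s) ^ r"
    proof -
      have "fact r * (n * s choose r) \<le> (n * s) ^ r"
        using binomial_fact_pow[of "n * s" r] by (simp add: mult.commute)
      hence "real (fact r * (n * s choose r)) \<le> real ((n * s) ^ r)" by (simp only: of_nat_le_iff)
      thus ?thesis by simp
    qed
    have chpos: "real (n * s choose r) > 0" using nr by simp
    have "\<alpha> + \<epsilon> = real n ^ r * p / (real n * real s) ^ r"
      by (simp add: \<epsilon>_def n_def power_mult_distrib)
    also have "\<dots> \<le> real n ^ r * p / (fact r * real (n * s choose r))"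
      using chle chpos p0 by (intro divide_left_mono mult_pos_pos mult_nonneg_nonneg zero_less_power) (auto simp: n_def s0)
    also have "\<dots> = density r VB (EB VB)"
      unfolding cE[symmetric] by (simp add: density_def cVB)
    finally have dens: "density r VB (EB VB) \<ge> \<alpha> + \<epsilon>" .
    have "card VB > n0" using ns by (simp add: cVB)
    then obtain W F where WF: "uniform_subgraph r W F VB (EB VB)" "card W = m"
      "density r W F \<ge> \<alpha> + c"
      using n0[of VB "EB VB"] UG dens by blast
    have W: "W \<subseteq> VB" "finite W" using WF by (auto simp: uniform_subgraph_def uniform_graph_def)
    have "F \<subseteq> EB W" using WF by (auto simp: uniform_subgraph_def uniform_graph_def EB_def)
    moreover have "finite (EB W)" using W by (auto simp: EB_def)
    ultimately have "card F \<le> card (EB W)" by (rule card_mono[rotated])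
    \<comment> \<open>The numbers of elements of \<open>W\<close> in the classes are weights with at most \<open>m\<close> non-zero entries.\<close>
    moreover have "fact r * edge_poly E (\<lambda>v. real (card {x \<in> W. \<tau> x = v})) \<le>
        \<alpha> * (\<Sum>v\<in>V. real (card {x \<in> W. \<tau> x = v})) ^ r"
    proof (rule loc)
      have "{v \<in> V. real (card {x \<in> W. \<tau> x = v}) \<noteq> 0} \<subseteq> \<tau> ` W"
        by (auto simp: card_eq_0_iff)
      hence "card {v \<in> V. real (card {x \<in> W. \<tau> x = v}) \<noteq> 0} \<le> card (\<tau> ` W)"
        using W by (intro card_mono) auto
      also have "\<dots> \<le> m" using card_image_le[OF W(2)] WF by simp
      finally show "card {v \<in> V. real (card {x \<in> W. \<tau> x = v}) \<noteq> 0} \<le> m" .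
    qed auto
    moreover have "(\<Sum>v\<in>V. real (card {x \<in> W. \<tau> x = v})) = real m"
      using cardW[OF W(1)] WF(2) by (metis of_nat_sum)
    ultimately have up: "fact r * real (card F) \<le> \<alpha> * real m ^ r"
      using cEB[OF W(1)] by (smt (verit) fact_ge_zero mult_left_mono of_nat_le_iff)
    have chm: "real (m choose r) > 0" using m by simp
    have "(\<alpha> + c) * real (m choose r) \<le> real (card F)"
      using WF(3) chm by (simp add: density_def WF(2) field_simps)
    hence "(\<alpha> + c) * (fact r * real (m choose r)) \<le> fact r * real (card F)"
      by (simp add: mult.left_commute mult_left_mono)
    with up m(2) show False by simp
  qed
  thus ?thesis using assms by (simp add: non_jump_def)
qed

section \<open>Raising the uniformity\<close>

lemma weighted_am_gm:
  fixes s y :: real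
  assumes "0 \<le> s" "0 \<le> y"
  shows "(real r + 1) ^ Suc r * (s ^ r * y) \<le> real r ^ r * (s + y) ^ Suc r"
proof (cases "r = 0 \<or> s = 0")
  case True
  thus ?thesis using assms by (cases "r = 0") (auto simp: power_0_left)
next
  case False
  hence r: "real r > 0" and s: "s > 0" using assms by auto
  define u where "u = s / real r"
  define g where "g = (s + y) / (real r + 1)"
  have u: "u > 0" "s = real r * u" using r s by (auto simp: u_def)
  have g: "g \<ge> 0" "s + y = (real r + 1) * g" using assms r by (auto simp: g_def)
  have "1 + real (Suc r) * (g / u - 1) \<le> (1 + (g / u - 1)) ^ Suc r"
    using u g by (intro Bernoulli_inequality) auto
  hence "u ^ Suc r * (1 + real (Suc r) * (g / u - 1)) \<le> u ^ Suc r * (g / u) ^ Suc r"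
    using u by (intro mult_left_mono) auto
  also have "\<dots> = g ^ Suc r" using u by (simp add: power_divide)
  also have "u ^ Suc r * (1 + real (Suc r) * (g / u - 1)) = u ^ r * (u + (real r + 1) * (g - u))"
    using u by (simp add: field_simps)
  also have "u + (real r + 1) * (g - u) = y" using u g by (simp add: algebra_simps)
  finally have "u ^ r * y \<le> g ^ Suc r" .
  hence "((real r + 1) ^ Suc r * real r ^ r) * (u ^ r * y) \<le> ((real r + 1) ^ Suc r * real r ^ r) * g ^ Suc r"
    using r by (intro mult_left_mono) auto
  moreover have "(s + y) ^ Suc r = (real r + 1) ^ Suc r * g ^ Suc r"
    unfolding g(2) by (rule power_mult_distrib)
  moreover have "s ^ r = real r ^ r * u ^ r" unfolding u(2) by (rule power_mult_distrib)
  ultimately show ?thesis by (simp only: mult_ac)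
qed

text \<open>
  If \<open>z\<close> is added to all edges, the edge polynomial is multiplied by the weight of \<open>z\<close>, and the best
  weight for \<open>z\<close> is the fraction \<open>1 / (r + 1)\<close> of the total.  This is where the factor comes from.
\<close>
lemma lagrangian_gap_Suc:
  assumes "lagrangian_gap r \<alpha>" "0 \<le> \<alpha>" "r \<ge> 1"
  shows "lagrangian_gap (Suc r) (\<alpha> * (real r / (real r + 1)) ^ r)"
  unfolding lagrangian_gap_def
proof
  fix m
  obtain V :: "nat set" and E w where G: "uniform_graph r V E"
    and w: "fact r * edge_poly E (\<lambda>v. real (w v)) > \<alpha> * (\<Sum>v\<in>V. real (w v)) ^ r"
    and loc: "\<And>y. (\<forall>v\<in>V. 0 \<le> y v) \<Longrightarrow> card {v \<in> V. y v \<noteq> 0} \<le> m \<Longrightarrow>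
      fact r * edge_poly E y \<le> \<alpha> * (\<Sum>v\<in>V. y v) ^ r"
    using assms(1) unfolding lagrangian_gap_def by meson
  have finV: "finite V" and EV: "\<And>e. e \<in> E \<Longrightarrow> e \<subseteq> V \<and> card e = r"
    using G by (auto simp: uniform_graph_def)
  have fe: "finite e \<and> card e = r" if "e \<in> E" for e
    using EV[OF that] finV finite_subset by blast
  obtain z where z: "z \<notin> V" using finV ex_new_if_finite infinite_UNIV_nat by blast
  have ze: "z \<notin> e" if "e \<in> E" for e using EV[OF that] z by blast
  have ep: "edge_poly (insert z ` E) y = y z * edge_poly E y" for y
    using fe ze by (intro edge_poly_insert_vertex) auto
  define s where "s = (\<Sum>v\<in>V. w v)"
  \<comment> \<open>The product \<open>S^r y\<close> with \<open>S + y\<close> fixed is largest at \<open>S = r y\<close>; these weights attain this ratio.\<close>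
  define w' where "w' v = (if v = z then s else r * w v)" for v
  have r: "real r > 0" using assms by simp
  have UG: "uniform_graph (Suc r) (insert z V) (insert z ` E)"
    using finV EV fe ze by (auto simp: uniform_graph_def)
  have eV: "edge_poly E (\<lambda>v. real (w' v)) = real r ^ r * edge_poly E (\<lambda>v. real (w v))"
  proof -
    have "(\<Prod>v\<in>e. real (w' v)) = (\<Prod>v\<in>e. real r * real (w v))" if "e \<in> E" for e
      using ze[OF that] by (intro prod.cong) (auto simp: w'_def)
    thus ?thesis using fe by (simp add: edge_poly_def prod.distrib sum_distrib_left)
  qed
  have s0: "s > 0" unfolding s_def using G assms(3,2) w by (rule gap_weights_pos)
  have "(\<Sum>v\<in>V. real (w' v)) = (\<Sum>v\<in>V. real r * real (w v))"
    using z by (intro sum.cong) (auto simp: w'_def)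
  also have "\<dots> = real r * real s" by (simp add: s_def sum_distrib_left)
  finally have sum': "(\<Sum>v\<in>insert z V. real (w' v)) = (real r + 1) * real s"
    using finV z by (simp add: w'_def algebra_simps)
  have "\<alpha> * (real r / (real r + 1)) ^ r * ((real r + 1) * real s) ^ Suc r =
      (real r + 1) * real s * real r ^ r * (\<alpha> * real s ^ r)"
    unfolding power_divide power_mult_distrib using r
    by (simp add: add_nonneg_eq_0_iff)
  also have "\<dots> < (real r + 1) * real s * real r ^ r * (fact r * edge_poly E (\<lambda>v. real (w v)))"
    using w s0 r by (intro mult_strict_left_mono mult_pos_pos) (simp add: s_def, simp_all)
  also have "\<dots> = fact (Suc r) * edge_poly (insert z ` E) (\<lambda>v. real (w' v))"
    unfolding ep eV by (simp add: w'_def algebra_simps)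
  finally have lower: "\<alpha> * (real r / (real r + 1)) ^ r * (\<Sum>v\<in>insert z V. real (w' v)) ^ Suc r
      < fact (Suc r) * edge_poly (insert z ` E) (\<lambda>v. real (w' v))"
    unfolding sum' .
  have upper: "fact (Suc r) * edge_poly (insert z ` E) y
      \<le> \<alpha> * (real r / (real r + 1)) ^ r * (\<Sum>v\<in>insert z V. y v) ^ Suc r"
    if y: "\<forall>v\<in>insert z V. 0 \<le> y v" "card {v \<in> insert z V. y v \<noteq> 0} \<le> m" for y
  proof -
    define S where "S = (\<Sum>v\<in>V. y v)"
    have "card {v \<in> V. y v \<noteq> 0} \<le> card {v \<in> insert z V. y v \<noteq> 0}"
      using finV by (intro card_mono) auto
    hence E: "fact r * edge_poly E y \<le> \<alpha> * S ^ r"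
      unfolding S_def using y by (intro loc) auto
    have S: "S \<ge> 0" using y by (auto simp: S_def intro: sum_nonneg)
    have yz: "y z \<ge> 0" using y by simp
    have "fact (Suc r) * edge_poly (insert z ` E) y = (real r + 1) * y z * (fact r * edge_poly E y)"
      unfolding ep by (simp add: algebra_simps)
    also have "\<dots> \<le> (real r + 1) * y z * (\<alpha> * S ^ r)"
      using yz by (intro mult_left_mono E) auto
    also have "\<dots> = \<alpha> / (real r + 1) ^ r * ((real r + 1) ^ Suc r * (S ^ r * y z))"
      using r by (simp add: field_simps)
    also have "\<dots> \<le> \<alpha> / (real r + 1) ^ r * (real r ^ r * (S + y z) ^ Suc r)"
      using assms yz S by (intro mult_left_mono weighted_am_gm) auto
    also have "\<dots> = \<alpha> * (real r / (real r + 1)) ^ r * (S + y z) ^ Suc r"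
      by (simp add: power_divide)
    also have "S + y z = (\<Sum>v\<in>insert z V. y v)" using finV z by (simp add: S_def)
    finally show ?thesis .
  qed
  show "\<exists>(V :: nat set) E. uniform_graph (Suc r) V E \<and>
     (\<exists>w :: nat \<Rightarrow> nat. fact (Suc r) * edge_poly E (\<lambda>v. real (w v)) >
        \<alpha> * (real r / (real r + 1)) ^ r * (\<Sum>v\<in>V. real (w v)) ^ Suc r) \<and>
     (\<forall>y. (\<forall>v\<in>V. 0 \<le> y v) \<longrightarrow> card {v \<in> V. y v \<noteq> 0} \<le> m \<longrightarrow>
        fact (Suc r) * edge_poly E y \<le>
          \<alpha> * (real r / (real r + 1)) ^ r * (\<Sum>v\<in>V. y v) ^ Suc r)"
    using UG lower upper by blast
qed

section \<open>Complete 3-graphs\<close>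

definition ksubsets :: "'a set \<Rightarrow> nat \<Rightarrow> 'a set set" where
  "ksubsets S k = {e. e \<subseteq> S \<and> card e = k}"

lemma finite_ksubsets [simp]: "finite S \<Longrightarrow> finite (ksubsets S k)"
  by (simp add: ksubsets_def)

lemma ksubsets_0: "finite S \<Longrightarrow> ksubsets S 0 = {{}}"
  by (auto simp: ksubsets_def dest: finite_subset)

lemma ksubsets_empty: "ksubsets {} (Suc k) = {}"
  by (auto simp: ksubsets_def)

lemma edge_poly_ksubsets_insert:
  assumes "finite S" "a \<notin> S"
  shows "edge_poly (ksubsets (insert a S) (Suc k)) y =
         edge_poly (ksubsets S (Suc k)) y + y a * edge_poly (ksubsets S k) y"
proof -
  have fin: "finite e" if "e \<subseteq> insert a S" for e
    using that assms finite_subset by blast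
  have "ksubsets (insert a S) (Suc k) - ksubsets S (Suc k) = insert a ` ksubsets S k"
  proof (intro equalityI subsetI)
    fix e assume e: "e \<in> ksubsets (insert a S) (Suc k) - ksubsets S (Suc k)"
    hence "a \<in> e" by (auto simp: ksubsets_def)
    moreover have "e - {a} \<in> ksubsets S k" using e fin \<open>a \<in> e\<close> by (auto simp: ksubsets_def)
    ultimately show "e \<in> insert a ` ksubsets S k" by (metis image_eqI insert_Diff)
  next
    fix e assume "e \<in> insert a ` ksubsets S k"
    then obtain f where f: "e = insert a f" "f \<subseteq> S" "card f = k" by (auto simp: ksubsets_def)
    moreover have "a \<notin> f" "finite f" using f assms finite_subset by auto
    ultimately show "e \<in> ksubsets (insert a S) (Suc k) - ksubsets S (Suc k)"
      using assms by (auto simp: ksubsets_def)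
  qed
  moreover have "edge_poly (insert a ` ksubsets S k) y = y a * edge_poly (ksubsets S k) y"
    using assms finite_subset by (intro edge_poly_insert_vertex) (auto simp: ksubsets_def)
  moreover have "ksubsets S (Suc k) \<subseteq> ksubsets (insert a S) (Suc k)"
    by (auto simp: ksubsets_def)
  ultimately show ?thesis using assms
    by (subst edge_poly_split[of _ "ksubsets S (Suc k)"]) auto
qed

lemma edge_poly_ksubsets_1: "finite S \<Longrightarrow> edge_poly (ksubsets S 1) y = (\<Sum>v\<in>S. y v)"
  by (induction S rule: finite_induct)
     (simp_all add: ksubsets_empty edge_poly_ksubsets_insert ksubsets_0, simp_all add: edge_poly_def)

lemma edge_poly_ksubsets_2: "finite S \<Longrightarrow>
  2 * edge_poly (ksubsets S 2) y = (\<Sum>v\<in>S. y v) ^ 2 - (\<Sum>v\<in>S. y v ^ 2)"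
proof (induction S rule: finite_induct)
  case empty
  show ?case by (simp add: edge_poly_def numeral_2_eq_2 ksubsets_empty)
next
  case (insert a S)
  hence "edge_poly (ksubsets (insert a S) 2) y = edge_poly (ksubsets S 2) y + y a * (\<Sum>v\<in>S. y v)"
    using edge_poly_ksubsets_insert[of S a 1 y] edge_poly_ksubsets_1[of S y] by (simp add: numeral_2_eq_2)
  thus ?case using insert by (simp add: power2_eq_square algebra_simps)
qed

lemma edge_poly_ksubsets_3: "finite S \<Longrightarrow>
  6 * edge_poly (ksubsets S 3) y =
    (\<Sum>v\<in>S. y v) ^ 3 - 3 * (\<Sum>v\<in>S. y v) * (\<Sum>v\<in>S. y v ^ 2) + 2 * (\<Sum>v\<in>S. y v ^ 3)"
proof (induction S rule: finite_induct)
  case empty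
  show ?case by (simp add: edge_poly_def numeral_3_eq_3 ksubsets_empty)
next
  case (insert a S)
  have "edge_poly (ksubsets (insert a S) 3) y = edge_poly (ksubsets S 3) y + y a * edge_poly (ksubsets S 2) y"
    using edge_poly_ksubsets_insert[of S a 2 y] insert by (simp add: numeral_2_eq_2 numeral_3_eq_3)
  hence "6 * edge_poly (ksubsets (insert a S) 3) y = 6 * edge_poly (ksubsets S 3) y + 3 * y a * (2 * edge_poly (ksubsets S 2) y)"
    by simp
  thus ?case using insert edge_poly_ksubsets_2[of S y] by (simp add: power2_eq_square power3_eq_cube algebra_simps)
qed

text \<open>
  Maclaurin's inequality for the third elementary symmetric polynomial.  With \<open>c = \<Sum>z\<close> the defect is
  \<open>\<Sum>j. 3 c z_j^2 - 2 z_j^3\<close>.  The summand is not convex on all of \<open>[0, c]\<close>, but for \<open>k \<ge> 4\<close> it still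
  lies above its tangent at the mean \<open>h = c / k\<close>, which gives the minimum at equal weights.
\<close>
lemma edge_poly_ksubsets_3_le:
  assumes "finite J" "card J \<ge> 4" "\<And>j. j \<in> J \<Longrightarrow> 0 \<le> z j"
  shows "6 * edge_poly (ksubsets J 3) z \<le>
         (1 - (3 * real (card J) - 2) / real (card J) ^ 2) * (\<Sum>j\<in>J. z j) ^ 3"
proof -
  define c k h where "c = (\<Sum>j\<in>J. z j)" and "k = real (card J)" and "h = c / k"
  have k: "k \<ge> 4" using assms by (simp add: k_def)
  have c0: "c \<ge> 0" using assms by (auto simp: c_def intro: sum_nonneg)
  have hc: "4 * h \<le> c" using k c0 mult_right_mono[OF k c0] by (simp add: h_def field_simps)
  have tangent: "3 * c * z j ^ 2 - 2 * z j ^ 3 \<ge> 3 * c * h ^ 2 - 2 * h ^ 3 + (6 * c * h - 6 * h ^ 2) * (z j - h)"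
    if "j \<in> J" for j
  proof -
    have "z j \<le> c" unfolding c_def using assms that by (intro member_le_sum) auto
    hence "0 \<le> (z j - h) ^ 2 * (3 * c - 4 * h - 2 * z j)" using hc by (intro mult_nonneg_nonneg) auto
    thus ?thesis by (simp add: power2_eq_square power3_eq_cube algebra_simps)
  qed
  have hk: "k * h = c" using k by (simp add: h_def)
  have "(\<Sum>j\<in>J. 3 * c * h ^ 2 - 2 * h ^ 3 + (6 * c * h - 6 * h ^ 2) * (z j - h)) \<le>
      (\<Sum>j\<in>J. 3 * c * z j ^ 2 - 2 * z j ^ 3)"
    by (intro sum_mono tangent)
  also have "(\<Sum>j\<in>J. 3 * c * h ^ 2 - 2 * h ^ 3 + (6 * c * h - 6 * h ^ 2) * (z j - h)) =
      k * (3 * c * h ^ 2 - 2 * h ^ 3) + (6 * c * h - 6 * h ^ 2) * (c - k * h)"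
    by (simp add: sum.distrib sum_subtractf sum_distrib_left[symmetric] c_def[symmetric] k_def)
  also have "\<dots> = (3 * k - 2) / k ^ 2 * c ^ 3"
    unfolding hk unfolding h_def using k by (simp add: field_simps power2_eq_square power3_eq_cube)
  also have "(\<Sum>j\<in>J. 3 * c * z j ^ 2 - 2 * z j ^ 3) = 3 * c * (\<Sum>j\<in>J. z j ^ 2) - 2 * (\<Sum>j\<in>J. z j ^ 3)"
    by (simp add: sum_subtractf sum_distrib_left)
  finally show ?thesis using edge_poly_ksubsets_3[OF assms(1), of z]
    unfolding c_def[symmetric] k_def[symmetric] by (simp add: algebra_simps)
qed

section \<open>The edge polynomial of a sparse triple system\<close>

text \<open>
  Lower all weights by their minimum \<open>\<mu>\<close>, attained at some \<open>w \<noteq> u\<close>.  The left side drops by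
  \<open>card F * \<mu>\<close> and the right side by \<open>(card S - 1) * \<mu>\<close>, which is at least as much; afterwards the
  edges through \<open>w\<close> contribute nothing and \<open>w\<close> can be removed.
\<close>
lemma sum_Min_le_of_sparse:
  fixes x :: "'a \<Rightarrow> real"
  assumes "finite S" "u \<in> S" "\<And>e. e \<in> F \<Longrightarrow> e \<subseteq> S \<and> e \<noteq> {}"
    and "\<And>S'. S' \<subseteq> S \<Longrightarrow> S' \<noteq> {} \<Longrightarrow> card {e \<in> F. e \<subseteq> S'} \<le> card S' - 1"
    and "\<And>v. v \<in> S \<Longrightarrow> 0 \<le> x v \<and> x v \<le> x u"
  shows "(\<Sum>e\<in>F. Min (x ` e)) \<le> (\<Sum>v\<in>S. x v) - x u"
  using assms
proof (induction "card S" arbitrary: S F x)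
  case 0
  thus ?case by simp
next
  case (Suc n)
  have finF: "finite F" using Suc.prems(1,3) by (metis Pow_iff finite_Pow_iff finite_subset subsetI)
  show ?case
  proof (cases "S = {u}")
    case True
    have "F = {e \<in> F. e \<subseteq> S}" using Suc.prems(3) by auto
    hence "card F = 0" using Suc.prems(4)[of S] True by simp
    hence "F = {}" using finF by simp
    thus ?thesis using True by simp
  next
    case False
    hence ne: "S - {u} \<noteq> {}" using Suc.prems by auto
    have "Min (x ` (S - {u})) \<in> x ` (S - {u})" using ne Suc.prems by (intro Min_in) auto
    then obtain w where w': "Min (x ` (S - {u})) = x w" "w \<in> S - {u}" by (rule imageE)
    hence w: "w \<in> S" "w \<noteq> u" "x w = Min (x ` (S - {u}))" by simp_all
    define \<mu> where "\<mu> = x w"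
    have wmin: "\<mu> \<le> x v" if "v \<in> S" for v
    proof (cases "v = u")
      case True
      thus ?thesis using Suc.prems(5)[OF w(1)] by (simp add: \<mu>_def)
    next
      case False
      thus ?thesis using that w Suc.prems by (auto simp: \<mu>_def)
    qed
    define x' where "x' v = x v - \<mu>" for v
    define F' where "F' = {e \<in> F. e \<subseteq> S - {w}}"
    have fe: "finite e" if "e \<in> F" for e using Suc.prems that finite_subset by blast
    have shift: "Min (x ` e) = Min (x' ` e) + \<mu>" if "e \<in> F" for e
      using Min_add_commute[of e x' \<mu>] fe[OF that] Suc.prems(3)[OF that] by (simp add: x'_def)
    have zero: "Min (x' ` e) = 0" if "e \<in> F" "e \<notin> F'" for e
    proof (rule Min_eqI)
      have "w \<in> e" using that Suc.prems(3)[of e] by (auto simp: F'_def)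
      thus "0 \<in> x' ` e" by (auto simp: x'_def \<mu>_def image_iff)
      fix y assume "y \<in> x' ` e"
      thus "0 \<le> y" using Suc.prems(3)[OF that(1)] wmin by (auto simp: x'_def)
    qed (use fe that in auto)
    have F'S: "{e \<in> F'. e \<subseteq> S'} = {e \<in> F. e \<subseteq> S'}" if "S' \<subseteq> S - {w}" for S'
      using that by (auto simp: F'_def)
    have IH: "(\<Sum>e\<in>F'. Min (x' ` e)) \<le> (\<Sum>v\<in>S - {w}. x' v) - x' u"
    proof (rule Suc.hyps(1))
      show "n = card (S - {w})" using Suc.hyps(2) Suc.prems(1) w(1) by simp
      show "card {e \<in> F'. e \<subseteq> S'} \<le> card S' - 1" if "S' \<subseteq> S - {w}" "S' \<noteq> {}" for S'
        unfolding F'S[OF that(1)] using that by (intro Suc.prems(4)) auto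
      show "\<And>v. v \<in> S - {w} \<Longrightarrow> 0 \<le> x' v \<and> x' v \<le> x' u"
        using wmin Suc.prems(5) by (simp add: x'_def)
      show "\<And>e. e \<in> F' \<Longrightarrow> e \<subseteq> S - {w} \<and> e \<noteq> {}" using Suc.prems(3) by (auto simp: F'_def)
    qed (use Suc.prems(1,2) w(1,2) in auto)
    have "(\<Sum>e\<in>F. Min (x ` e)) = (\<Sum>e\<in>F. Min (x' ` e)) + real (card F) * \<mu>"
      using shift by (simp add: sum.distrib)
    also have "(\<Sum>e\<in>F. Min (x' ` e)) = (\<Sum>e\<in>F'. Min (x' ` e))"
      using finF zero by (intro sum.mono_neutral_right) (auto simp: F'_def)
    also have "\<dots> \<le> (\<Sum>v\<in>S - {w}. x' v) - x' u" by (rule IH)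
    also have "(\<Sum>v\<in>S - {w}. x' v) = (\<Sum>v\<in>S. x' v)"
      using Suc.prems w by (subst sum.remove[of S w]) (auto simp: x'_def \<mu>_def)
    also have "\<dots> = (\<Sum>v\<in>S. x v) - real (card S) * \<mu>" by (simp add: x'_def sum_subtractf)
    finally have *: "(\<Sum>e\<in>F. Min (x ` e)) \<le> (\<Sum>v\<in>S. x v) - x u + \<mu> - (real (card S) - real (card F)) * \<mu>"
      by (simp add: x'_def algebra_simps)
    have "{e \<in> F. e \<subseteq> S} = F" using Suc.prems(3) by auto
    hence "card F \<le> card S - 1" using Suc.prems(4)[of S] Suc.prems(2) by auto
    hence "1 * \<mu> \<le> (real (card S) - real (card F)) * \<mu>"
      using Suc.hyps(2) Suc.prems(5)[OF w(1)] by (intro mult_right_mono) (auto simp: \<mu>_def)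
    with * show ?thesis by simp
  qed
qed

lemma edge_poly_sparse_le:
  fixes x :: "'a \<Rightarrow> real"
  assumes "finite S" "u \<in> S" "\<And>e. e \<in> F \<Longrightarrow> e \<subseteq> S \<and> card e = 3"
    and "\<And>S'. S' \<subseteq> S \<Longrightarrow> S' \<noteq> {} \<Longrightarrow> card {e \<in> F. e \<subseteq> S'} \<le> card S' - 1"
    and "\<And>v. v \<in> S \<Longrightarrow> 0 \<le> x v \<and> x v \<le> x u"
  shows "edge_poly F x \<le> x u ^ 2 * ((\<Sum>v\<in>S. x v) - x u)"
proof -
  have "(\<Prod>v\<in>e. x v) \<le> x u ^ 2 * Min (x ` e)" if e: "e \<in> F" for e
  proof -
    have fe: "finite e" "e \<noteq> {}" using assms(3)[OF e] by (auto intro: card_ge_0_finite)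
    have "Min (x ` e) \<in> x ` e" using fe by (intro Min_in) auto
    then obtain w where w: "w \<in> e" "x w = Min (x ` e)" by auto
    have S: "v \<in> S" if "v \<in> e" for v using that assms(3)[OF e] by auto
    have "(\<Prod>v\<in>e - {w}. x v) \<le> (\<Prod>v\<in>e - {w}. x u)"
      using S assms(5) by (intro prod_mono) auto
    also have "\<dots> = x u ^ 2" using w fe assms(3)[OF e] by simp
    finally have "x w * (\<Prod>v\<in>e - {w}. x v) \<le> x w * x u ^ 2"
      using assms(5)[OF S[OF w(1)]] by (intro mult_left_mono) simp_all
    thus ?thesis using w fe by (simp add: prod.remove[of e w] mult.commute)
  qed
  hence "edge_poly F x \<le> (\<Sum>e\<in>F. x u ^ 2 * Min (x ` e))"
    unfolding edge_poly_def by (intro sum_mono)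
  also have "\<dots> = x u ^ 2 * (\<Sum>e\<in>F. Min (x ` e))" by (simp add: sum_distrib_left)
  also have "\<dots> \<le> x u ^ 2 * ((\<Sum>v\<in>S. x v) - x u)"
  proof (intro mult_left_mono sum_Min_le_of_sparse)
    show "\<And>e. e \<in> F \<Longrightarrow> e \<subseteq> S \<and> e \<noteq> {}" using assms(3) by fastforce
  qed (use assms in auto)
  finally show ?thesis .
qed

section \<open>Sparse triple systems by the deletion method\<close>

text \<open>
  The function \<open>\<phi>\<close> is affine in each coordinate, so moving one coordinate after the other to one of the
  ends of \<open>[0, 1]\<close> can be done without decreasing it.  At the constant \<open>p\<close> the value of \<open>\<phi>\<close> is the
  expected number of edges minus the expected number of bad configurations \<open>B i\<close> in a random set of
  density \<open>p\<close>; rounding replaces the choice of a random set.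
\<close>
lemma round_multilinear:
  fixes B :: "'i \<Rightarrow> 'a set" and T :: "'a set" and I :: "'i set"
  defines "\<phi> \<equiv> \<lambda>x. (\<Sum>e\<in>T. x e) - (\<Sum>i\<in>I. \<Prod>e\<in>B i. (x e :: real))"
  assumes T: "finite T" and B: "\<And>i. i \<in> I \<Longrightarrow> finite (B i)"
  assumes "finite U" "U \<subseteq> T" "\<And>e. e \<in> T \<Longrightarrow> 0 \<le> x e \<and> x e \<le> 1"
  shows "\<exists>x'. (\<forall>e\<in>U. x' e = 0 \<or> x' e = 1) \<and> (\<forall>e. e \<notin> U \<longrightarrow> x' e = x e) \<and> \<phi> x \<le> \<phi> x'"
  using assms(4-6)
proof (induction U arbitrary: x rule: finite_induct)
  case empty
  thus ?case by auto
next
  case (insert a U x)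
  have aT: "a \<in> T" using insert.prems by auto
  have T_upd: "(\<Sum>e\<in>T. (x(a := s)) e) = s + (\<Sum>e\<in>T - {a}. x e)" for s
    using T aT by (subst sum.remove[of T a]) (auto intro!: sum.cong)
  have B_upd: "(\<Prod>e\<in>B i. (x(a := s)) e) =
      s * (\<Prod>e\<in>B i. (x(a := 1)) e) + (1 - s) * (\<Prod>e\<in>B i. (x(a := 0)) e)" if "i \<in> I" for i s
  proof (cases "a \<in> B i")
    case True
    have "(\<Prod>e\<in>B i. (x(a := r)) e) = r * (\<Prod>e\<in>B i - {a}. x e)" for r
      using B[OF that] True by (subst prod.remove[of "B i" a]) (auto intro!: prod.cong)
    thus ?thesis by (simp only: mult_1 mult_zero_left mult_zero_right add_0_right)
  next
    case False
    have "(\<Prod>e\<in>B i. (x(a := r)) e) = (\<Prod>e\<in>B i. x e)" for r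
      using False by (intro prod.cong) auto
    thus ?thesis by (simp only: left_diff_distrib)
  qed
  have affine: "\<phi> (x(a := s)) = s * \<phi> (x(a := 1)) + (1 - s) * \<phi> (x(a := 0))" for s
  proof -
    have "(\<Sum>i\<in>I. \<Prod>e\<in>B i. (x(a := s)) e) = (\<Sum>i\<in>I. s * (\<Prod>e\<in>B i. (x(a := 1)) e) + (1 - s) * (\<Prod>e\<in>B i. (x(a := 0)) e))"
      by (intro sum.cong refl B_upd)
    also have "\<dots> = s * (\<Sum>i\<in>I. \<Prod>e\<in>B i. (x(a := 1)) e) + (1 - s) * (\<Sum>i\<in>I. \<Prod>e\<in>B i. (x(a := 0)) e)"
      by (simp only: sum.distrib sum_distrib_left)
    finally have "(\<Sum>i\<in>I. \<Prod>e\<in>B i. (x(a := s)) e) =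
      s * (\<Sum>i\<in>I. \<Prod>e\<in>B i. (x(a := 1)) e) + (1 - s) * (\<Sum>i\<in>I. \<Prod>e\<in>B i. (x(a := 0)) e)" .
    thus ?thesis unfolding \<phi>_def T_upd by (simp only:) (simp add: algebra_simps)
  qed
  have xa: "0 \<le> x a" "x a \<le> 1" using insert.prems aT by auto
  have "\<exists>b\<in>{0, 1}. \<phi> x \<le> \<phi> (x(a := b))"
  proof (rule ccontr)
    assume "\<not> ?thesis"
    hence less: "\<phi> (x(a := 0)) < \<phi> x" "\<phi> (x(a := 1)) < \<phi> x" by auto
    have "\<phi> x = x a * \<phi> (x(a := 1)) + (1 - x a) * \<phi> (x(a := 0))"
      using affine[of "x a"] by simp
    also have "\<dots> < \<phi> x" using less xa
      by (intro convex_bound_lt) auto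
    finally show False by simp
  qed
  then obtain b where b: "b = 0 \<or> b = 1" "\<phi> x \<le> \<phi> (x(a := b))" by auto
  have "\<exists>x'. (\<forall>e\<in>U. x' e = 0 \<or> x' e = 1) \<and> (\<forall>e. e \<notin> U \<longrightarrow> x' e = (x(a := b)) e) \<and>
      \<phi> (x(a := b)) \<le> \<phi> x'"
    using insert.prems b(1) by (intro insert.IH) auto
  then obtain x' where "\<forall>e\<in>U. x' e = 0 \<or> x' e = 1" "\<forall>e. e \<notin> U \<longrightarrow> x' e = (x(a := b)) e"
    "\<phi> (x(a := b)) \<le> \<phi> x'" by blast
  thus ?case using b insert.hyps by (intro exI[of _ x']) auto
qed

lemma deletion_method:
  fixes B :: "'i \<Rightarrow> 'a set"
  assumes "finite T" "finite I" "\<And>i. i \<in> I \<Longrightarrow> B i \<subseteq> T \<and> B i \<noteq> {}" "0 \<le> p" "p \<le> 1"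
  shows "\<exists>F\<subseteq>T. (\<forall>i\<in>I. \<not> B i \<subseteq> F) \<and>
           p * real (card T) - (\<Sum>i\<in>I. p ^ card (B i)) \<le> real (card F)"
proof -
  have Bf: "finite (B i)" if "i \<in> I" for i using assms that finite_subset by blast
  have "\<exists>x. (\<forall>e\<in>T. x e = 0 \<or> x e = 1) \<and> (\<forall>e. e \<notin> T \<longrightarrow> x e = p) \<and>
      (\<Sum>e\<in>T. p) - (\<Sum>i\<in>I. \<Prod>e\<in>B i. p) \<le> (\<Sum>e\<in>T. x e) - (\<Sum>i\<in>I. \<Prod>e\<in>B i. x e)"
    by (rule round_multilinear) (use assms Bf in auto)
  then obtain x where x: "\<And>e. e \<in> T \<Longrightarrow> x e = 0 \<or> x e = (1 :: real)"
    and le: "(\<Sum>e\<in>T. p) - (\<Sum>i\<in>I. \<Prod>e\<in>B i. p) \<le> (\<Sum>e\<in>T. x e) - (\<Sum>i\<in>I. \<Prod>e\<in>B i. x e)"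
    by blast
  define X where "X = {e \<in> T. x e = 1}"
  define J where "J = {i \<in> I. B i \<subseteq> X}"
  have "(\<Sum>e\<in>T. x e) = (\<Sum>e\<in>T. if e \<in> X then 1 else 0)"
    using x by (intro sum.cong) (auto simp: X_def)
  also have "\<dots> = real (card X)"
    using assms(1) by (simp add: sum.If_cases X_def Int_def conj_commute)
  finally have sx: "(\<Sum>e\<in>T. x e) = real (card X)" .
  have "(\<Prod>e\<in>B i. x e) = (if i \<in> J then 1 else 0)" if i: "i \<in> I" for i
  proof (cases "i \<in> J")
    case True
    thus ?thesis by (auto simp: J_def X_def intro!: prod.neutral)
  next
    case False
    then obtain e where "e \<in> B i" "e \<notin> X" using i by (auto simp: J_def)
    hence "x e = 0" using x assms(3)[OF i] by (auto simp: X_def)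
    thus ?thesis using False Bf[OF i] \<open>e \<in> B i\<close> by (auto simp: prod_zero_iff)
  qed
  hence "(\<Sum>i\<in>I. \<Prod>e\<in>B i. x e) = (\<Sum>i\<in>I. if i \<in> J then 1 else 0)" by (intro sum.cong) auto
  also have "\<dots> = real (card J)"
    using assms(2) by (simp add: sum.If_cases J_def Int_def conj_commute)
  finally have sJ: "(\<Sum>i\<in>I. \<Prod>e\<in>B i. x e) = real (card J)" .
  define pick where "pick i = (SOME e. e \<in> B i)" for i
  have pick: "pick i \<in> B i" if "i \<in> I" for i
    unfolding pick_def using assms(3)[OF that] by (meson all_not_in_conv someI_ex)
  define F where "F = X - pick ` J"
  have finJ: "finite J" using assms by (simp add: J_def)
  have "card X - card (pick ` J) \<le> card F" unfolding F_def
    using finJ by (intro diff_card_le_card_Diff) auto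
  moreover have "card (pick ` J) \<le> card J" using finJ by (rule card_image_le)
  ultimately have "real (card X) - real (card J) \<le> real (card F)" by linarith
  hence "p * real (card T) - (\<Sum>i\<in>I. p ^ card (B i)) \<le> real (card F)"
    using le sx sJ by (simp add: mult.commute)
  moreover have "\<not> B i \<subseteq> F" if "i \<in> I" for i
    using pick[OF that] that by (auto simp: F_def J_def)
  moreover have "F \<subseteq> T" by (auto simp: F_def X_def)
  ultimately show ?thesis by blast
qed

lemma sum_power_card_le:
  assumes "finite A" "K \<ge> 1" "card A \<ge> 1"
  shows "(\<Sum>S | S \<subseteq> A \<and> S \<noteq> {} \<and> card S \<le> m. (K / real (card A)) ^ card S) \<le> real (m + 1) * K ^ m"
proof -
  define p where "p = K / real (card A)"
  define \<S> where "\<S> = {S. S \<subseteq> A \<and> S \<noteq> {} \<and> card S \<le> m}"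
  have p: "p \<ge> 0" "real (card A) * p = K" using assms by (auto simp: p_def)
  have fin: "finite \<S>" using assms by (auto simp: \<S>_def)
  have "(\<Sum>S\<in>\<S>. p ^ card S) = (\<Sum>s\<in>{..m}. \<Sum>S | S \<in> \<S> \<and> card S = s. p ^ card S)"
    using fin by (subst sum.group) (auto simp: \<S>_def)
  also have "\<dots> \<le> (\<Sum>s\<in>{..m}. K ^ m)"
  proof (rule sum_mono)
    fix s assume "s \<in> {..m}"
    have "(\<Sum>S | S \<in> \<S> \<and> card S = s. p ^ card S) = (\<Sum>S | S \<in> \<S> \<and> card S = s. p ^ s)"
      by (intro sum.cong) auto
    also have "\<dots> = real (card {S \<in> \<S>. card S = s}) * p ^ s" by simp
    also have "\<dots> \<le> real (card A ^ s) * p ^ s"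
    proof -
      have "card {S \<in> \<S>. card S = s} \<le> card {S. S \<subseteq> A \<and> card S = s}"
        using assms by (intro card_mono) (auto simp: \<S>_def)
      also have "\<dots> = card A choose s" using assms n_subsets by blast
      also have "\<dots> \<le> (card A choose s) * fact s" by simp
      also have "\<dots> \<le> card A ^ s" by (rule binomial_fact_pow)
      finally have "real (card {S \<in> \<S>. card S = s}) \<le> real (card A ^ s)" by (simp only: of_nat_le_iff)
      thus ?thesis using p by (intro mult_right_mono) auto
    qed
    also have "\<dots> = K ^ s" using p(2) by (simp add: power_mult_distrib[symmetric])
    also have "\<dots> \<le> K ^ m" using assms \<open>s \<in> {..m}\<close> by (intro power_increasing) auto
    finally show "(\<Sum>S | S \<in> \<S> \<and> card S = s. p ^ card S) \<le> K ^ m" .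
  qed
  also have "\<dots> = real (m + 1) * K ^ m" by simp
  finally show ?thesis by (simp add: p_def \<S>_def)
qed

text \<open>
  Choose each triple with probability \<open>p = K / t\<close>.  This gives about \<open>K t^2 / 6\<close> edges.  A bad
  configuration consists of \<open>s\<close> triples within \<open>s\<close> vertices; there are \<open>O(t^s)\<close> of them and each
  occurs with probability \<open>(K / t)^s\<close>, so the expected number of all bad configurations with \<open>s \<le> m\<close>
  is bounded independently of \<open>t\<close>, and removing one edge from each costs next to nothing.
\<close>
lemma ex_sparse_triple_system:
  fixes D :: real
  shows "\<exists>t\<^sub>0. \<forall>A :: 'a set. finite A \<and> card A \<ge> t\<^sub>0 \<longrightarrow>
     (\<exists>F \<subseteq> ksubsets A 3. D * real (card A) ^ 2 \<le> real (card F) \<and>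
        (\<forall>S\<subseteq>A. S \<noteq> {} \<and> card S \<le> m \<longrightarrow> card {e \<in> F. e \<subseteq> S} \<le> card S - 1))"
proof -
  \<comment> \<open>The expected number of edges is at least \<open>K t^2 / 24\<close>, of which at most half is lost.\<close>
  define K where "K = 48 * (\<bar>D\<bar> + 1)"
  define Q where "Q = 2 ^ 2 ^ m * (real (m + 1) * K ^ m)"
  have K: "K \<ge> 1" by (simp add: K_def)
  define t0 where "t0 = nat \<lceil>K\<rceil> + nat \<lceil>48 * Q\<rceil> + 4"
  have "\<exists>F \<subseteq> ksubsets A 3. D * real (card A) ^ 2 \<le> real (card F) \<and>
        (\<forall>S\<subseteq>A. S \<noteq> {} \<and> card S \<le> m \<longrightarrow> card {e \<in> F. e \<subseteq> S} \<le> card S - 1)"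
    if A: "finite A" "card A \<ge> t0" for A :: "'a set"
  proof -
    define t where "t = real (card A)"
    have "real t0 \<ge> K" "real t0 \<ge> 48 * Q" "real t0 \<ge> 4" unfolding t0_def by linarith+
    hence t: "t \<ge> K" "t \<ge> 48 * Q" "t \<ge> 4" using A unfolding t_def by linarith+
    define p where "p = K / t"
    have p: "0 \<le> p" "p \<le> 1" using K t by (auto simp: p_def)
    define \<S> where "\<S> = {S. S \<subseteq> A \<and> S \<noteq> {} \<and> card S \<le> m}"
    define \<B> where "\<B> S = {B. B \<subseteq> ksubsets S 3 \<and> card B = card S}" for S :: "'a set"
    have finS: "finite \<S>" using A by (auto simp: \<S>_def)
    have fS: "finite S" if "S \<in> \<S>" for S using that A finite_subset by (auto simp: \<S>_def)
    have finB: "finite (\<B> S)" if "S \<in> \<S>" for S using fS[OF that] by (simp add: \<B>_def)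
    have cB: "card (\<B> S) \<le> 2 ^ 2 ^ m" if "S \<in> \<S>" for S
    proof -
      have "\<B> S \<subseteq> Pow (Pow S)" by (auto simp: \<B>_def ksubsets_def)
      hence "card (\<B> S) \<le> card (Pow (Pow S))" using fS[OF that] by (intro card_mono) auto
      also have "\<dots> = 2 ^ 2 ^ card S" using fS[OF that] by (simp add: card_Pow)
      also have "\<dots> \<le> 2 ^ 2 ^ m" using that by (intro power_increasing) (auto simp: \<S>_def)
      finally show ?thesis .
    qed
    have "\<exists>F\<subseteq>ksubsets A 3. (\<forall>i\<in>Sigma \<S> \<B>. \<not> snd i \<subseteq> F) \<and>
        p * real (card (ksubsets A 3)) - (\<Sum>i\<in>Sigma \<S> \<B>. p ^ card (snd i)) \<le> real (card F)"
    proof (rule deletion_method)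
      fix i assume "i \<in> Sigma \<S> \<B>"
      then obtain S B where i: "i = (S, B)" "S \<in> \<S>" "B \<in> \<B> S" by auto
      have S: "S \<subseteq> A" "S \<noteq> {}" and B: "B \<subseteq> ksubsets S 3" "card B = card S"
        using i(2,3) by (simp_all add: \<S>_def \<B>_def)
      have "card B > 0" using S fS[OF i(2)] B(2) by (simp add: card_gt_0_iff)
      hence "B \<noteq> {}" by auto
      moreover have "B \<subseteq> ksubsets A 3" using B(1) S(1) by (auto simp: ksubsets_def)
      ultimately show "snd i \<subseteq> ksubsets A 3 \<and> snd i \<noteq> {}" by (simp add: i(1))
    next
      show "finite (Sigma \<S> \<B>)" using finS finB by (intro finite_SigmaI)
    qed (use A(1) p in simp_all)
    then obtain F where F: "F \<subseteq> ksubsets A 3" "\<And>S B. S \<in> \<S> \<Longrightarrow> B \<in> \<B> S \<Longrightarrow> \<not> B \<subseteq> F"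
      and cF: "p * real (card (ksubsets A 3)) - (\<Sum>i\<in>Sigma \<S> \<B>. p ^ card (snd i)) \<le> real (card F)"
      by (metis SigmaI snd_conv)
    have "(\<Sum>i\<in>Sigma \<S> \<B>. p ^ card (snd i)) = (\<Sum>S\<in>\<S>. \<Sum>B\<in>\<B> S. p ^ card B)"
      using finS finB by (subst sum.Sigma) (auto simp: case_prod_beta)
    also have "\<dots> \<le> (\<Sum>S\<in>\<S>. 2 ^ 2 ^ m * p ^ card S)"
    proof (rule sum_mono)
      fix S assume S: "S \<in> \<S>"
      have "(\<Sum>B\<in>\<B> S. p ^ card B) = real (card (\<B> S)) * p ^ card S" by (simp add: \<B>_def)
      also have "\<dots> \<le> real (2 ^ 2 ^ m) * p ^ card S"
        using cB[OF S] p by (intro mult_right_mono) (simp_all only: of_nat_le_iff zero_le_power)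
      finally show "(\<Sum>B\<in>\<B> S. p ^ card B) \<le> 2 ^ 2 ^ m * p ^ card S" by simp
    qed
    also have "\<dots> = 2 ^ 2 ^ m * (\<Sum>S\<in>\<S>. p ^ card S)" by (simp add: sum_distrib_left)
    also have "\<dots> \<le> Q" unfolding Q_def
      using sum_power_card_le[of A K m] A(1) K t by (intro mult_left_mono) (auto simp: p_def \<S>_def t_def)
    finally have bad: "(\<Sum>i\<in>Sigma \<S> \<B>. p ^ card (snd i)) \<le> Q" .
    have c3: "6 * real (card (ksubsets A 3)) = t ^ 3 - 3 * t ^ 2 + 2 * t"
      using edge_poly_ksubsets_3[OF A(1), of "\<lambda>_. 1"] by (simp add: card_eq_edge_poly t_def power2_eq_square)
    have "0 \<le> (t - 4) * (3 * t)" using t by (intro mult_nonneg_nonneg) auto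
    hence "t ^ 2 \<le> 4 * (t ^ 2 - 3 * t + 2)" by (simp add: power2_eq_square algebra_simps)
    hence "K * t ^ 2 \<le> K * (4 * (t ^ 2 - 3 * t + 2))" using K by (intro mult_left_mono) auto
    also have "\<dots> = 24 * (p * real (card (ksubsets A 3)))"
    proof -
      have "p * (6 * real (card (ksubsets A 3))) = K * (t ^ 2 - 3 * t + 2)"
        unfolding c3 p_def using t by (simp add: field_simps power2_eq_square power3_eq_cube)
      thus ?thesis by (simp add: algebra_simps)
    qed
    finally have edges: "K * t ^ 2 / 24 \<le> p * real (card (ksubsets A 3))" by simp
    have "1 * t \<le> (K * t) * t" using K t mult_mono[of 1 K 1 t] by (intro mult_right_mono) auto
    moreover have "K * t * t = K * t ^ 2" by (simp add: power2_eq_square)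
    ultimately have "48 * Q \<le> K * t ^ 2" using t by linarith
    hence "K * t ^ 2 / 48 \<le> real (card F)" using cF bad edges by linarith
    moreover have "D * t ^ 2 \<le> (\<bar>D\<bar> + 1) * t ^ 2" by (intro mult_right_mono) auto
    moreover have "K * t ^ 2 / 48 = (\<bar>D\<bar> + 1) * t ^ 2" by (simp add: K_def)
    ultimately have "D * t ^ 2 \<le> real (card F)" by linarith
    moreover have "card {e \<in> F. e \<subseteq> S} \<le> card S - 1" if S: "S \<subseteq> A" "S \<noteq> {}" "card S \<le> m" for S
    proof (rule ccontr)
      assume "\<not> ?thesis"
      hence "card S \<le> card {e \<in> F. e \<subseteq> S}" by linarith
      then obtain B where B: "B \<subseteq> {e \<in> F. e \<subseteq> S}" "card B = card S"
        by (rule obtain_subset_with_card_n)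
      have "B \<in> \<B> S" using B F(1) by (auto simp: \<B>_def ksubsets_def)
      moreover have "S \<in> \<S>" using S by (simp add: \<S>_def)
      ultimately show False using F(2) B by blast
    qed
    ultimately show ?thesis using F(1) unfolding t_def by blast
  qed
  thus ?thesis by blast
qed

section \<open>The 3-uniform patterns\<close>

lemma edge_poly_join:
  assumes "finite A" "finite C" "A \<inter> C = {}" "F \<subseteq> ksubsets A 3" "R \<subseteq> ksubsets C 3"
  defines "E \<equiv> ksubsets (A \<union> C) 3 - (ksubsets A 3 - F) - (ksubsets C 3 - R)"
  defines "a y \<equiv> \<Sum>v\<in>A. y v" and "c y \<equiv> \<Sum>v\<in>C. y v"
  shows "6 * edge_poly E y = (a y + c y) ^ 3 - a y ^ 3 - c y ^ 3
     - 3 * (c y * (\<Sum>v\<in>A. y v ^ 2) + a y * (\<Sum>v\<in>C. y v ^ 2)) + 6 * edge_poly F y + 6 * edge_poly R y"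
proof -
  have disj: "ksubsets A 3 \<inter> ksubsets C 3 = {}"
  proof (rule equals0I)
    fix e assume "e \<in> ksubsets A 3 \<inter> ksubsets C 3"
    hence "e \<subseteq> A \<inter> C" "card e = 3" by (auto simp: ksubsets_def)
    thus False using assms(3) by simp
  qed
  have sub: "ksubsets A 3 \<subseteq> ksubsets (A \<union> C) 3" "ksubsets C 3 \<subseteq> ksubsets (A \<union> C) 3"
    by (auto simp: ksubsets_def)
  have fin: "finite (ksubsets A 3)" "finite (ksubsets C 3)" "finite (ksubsets (A \<union> C) 3)"
    using assms by auto
  have 1: "edge_poly (ksubsets (A \<union> C) 3) y =
      edge_poly (ksubsets A 3 - F) y + edge_poly (ksubsets (A \<union> C) 3 - (ksubsets A 3 - F)) y"
    using sub fin by (intro edge_poly_split) auto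
  have 2: "edge_poly (ksubsets (A \<union> C) 3 - (ksubsets A 3 - F)) y =
      edge_poly (ksubsets C 3 - R) y + edge_poly E y"
    unfolding E_def using sub fin disj by (intro edge_poly_split) auto
  have 3: "edge_poly (ksubsets A 3) y = edge_poly F y + edge_poly (ksubsets A 3 - F) y"
    using fin assms(4) by (intro edge_poly_split) auto
  have 4: "edge_poly (ksubsets C 3) y = edge_poly R y + edge_poly (ksubsets C 3 - R) y"
    using fin assms(5) by (intro edge_poly_split) auto
  have un: "(\<Sum>v\<in>A \<union> C. f v) = (\<Sum>v\<in>A. f v) + (\<Sum>v\<in>C. f v)" for f :: "'a \<Rightarrow> real"
    using assms by (intro sum.union_disjoint) auto
  have "6 * edge_poly E y = 6 * edge_poly (ksubsets (A \<union> C) 3) y - 6 * edge_poly (ksubsets A 3) y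
      - 6 * edge_poly (ksubsets C 3) y + 6 * edge_poly F y + 6 * edge_poly R y"
    using 1 2 3 4 by simp
  also have "\<dots> = (a y + c y) ^ 3 - a y ^ 3 - c y ^ 3
     - 3 * (c y * (\<Sum>v\<in>A. y v ^ 2) + a y * (\<Sum>v\<in>C. y v ^ 2)) + 6 * edge_poly F y + 6 * edge_poly R y"
    using assms(1,2) by (simp add: edge_poly_ksubsets_3 un a_def c_def algebra_simps)
  finally show ?thesis .
qed

text \<open>
  The minimum of \<open>a^3 + \<theta>^2 c^3\<close> for fixed \<open>a + c\<close> is at \<open>a = \<theta> c\<close>, where the difference from the
  minimum must have a double root.
\<close>
lemma cubic_double_root:
  fixes a c \<theta> :: real
  assumes "\<theta> > 0"
  shows "a ^ 3 + \<theta> ^ 2 * c ^ 3 = (\<theta> / (1 + \<theta>)) ^ 2 * (a + c) ^ 3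
     + (a - \<theta> * c) ^ 2 * ((1 + 2 * \<theta>) * a + (2 * \<theta> + \<theta> ^ 2) * c) / (1 + \<theta>) ^ 2"
proof -
  have "(1 + \<theta>) ^ 2 * (a ^ 3 + \<theta> ^ 2 * c ^ 3) =
     \<theta> ^ 2 * (a + c) ^ 3 + (a - \<theta> * c) ^ 2 * ((1 + 2 * \<theta>) * a + (2 * \<theta> + \<theta> ^ 2) * c)"
    by (simp add: power2_eq_square power3_eq_cube algebra_simps)
  moreover have "(1 + \<theta>) ^ 2 \<noteq> 0" using assms by simp
  ultimately show ?thesis
    by (simp add: power_divide add_divide_distrib[symmetric] eq_divide_eq mult.commute)
qed

text \<open>
  The terms \<open>3 c M^2\<close> and \<open>6 M^2 (a - M)\<close> are the loss from repeated vertices of \<open>A\<close> and the gain from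
  the triple system.  Near the optimum \<open>a = \<theta> c\<close> the part \<open>A\<close> is so small that the loss dominates.
  If \<open>c < 2 a\<close>, the gain exceeds the loss by at most \<open>8/9 (a - c/2)^3\<close>, the maximum over \<open>M\<close>, but then
  \<open>a^3\<close> alone is much larger than the minimum of \<open>a^3 + \<theta>^2 c^3\<close>, because \<open>\<theta>\<close> is small.
\<close>
lemma local_deficit:
  fixes a c M \<theta> :: real
  assumes "0 < \<theta>" "\<theta> ^ 2 \<le> 1 / 81" "0 \<le> M" "M \<le> a" "0 \<le> c"
  shows "(\<theta> / (1 + \<theta>)) ^ 2 * (a + c) ^ 3 + 6 * (M ^ 2 * (a - M)) \<le> a ^ 3 + \<theta> ^ 2 * c ^ 3 + 3 * c * M ^ 2"
proof (cases "2 * a \<le> c")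
  case True
  have "6 * (M ^ 2 * (a - M)) \<le> 6 * (M ^ 2 * a)" using assms by (intro mult_left_mono) auto
  also have "\<dots> = 3 * M ^ 2 * (2 * a)" by simp
  also have "\<dots> \<le> 3 * M ^ 2 * c" using True by (intro mult_left_mono) auto
  finally have "6 * (M ^ 2 * (a - M)) \<le> 3 * c * M ^ 2" by (simp add: mult_ac)
  moreover have "(\<theta> / (1 + \<theta>)) ^ 2 * (a + c) ^ 3 \<le> a ^ 3 + \<theta> ^ 2 * c ^ 3"
    unfolding cubic_double_root[OF assms(1)] using assms by simp
  ultimately show ?thesis by linarith
next
  case False
  define d where "d = a - c / 2"
  have d: "0 \<le> d" "d \<le> a" using False assms by (auto simp: d_def)
  have "0 \<le> (3 * M - 2 * d) ^ 2 * (3 * M + d)" using assms d by (intro mult_nonneg_nonneg) auto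
  hence "6 * (M ^ 2 * (d - M)) \<le> 8 / 9 * (d ^ 2 * d)"
    by (simp add: power2_eq_square algebra_simps)
  also have "\<dots> \<le> 8 / 9 * (a ^ 2 * d)"
    using d by (intro mult_left_mono mult_right_mono power_mono) auto
  finally have 1: "6 * (M ^ 2 * (a - M)) - 3 * c * M ^ 2 \<le> 8 / 9 * (a ^ 2 * d)"
    by (simp add: d_def algebra_simps)
  have "\<theta> / (1 + \<theta>) \<le> \<theta>" using assms by (simp add: field_simps)
  hence "(\<theta> / (1 + \<theta>)) ^ 2 \<le> \<theta> ^ 2" using assms by (intro power_mono) auto
  hence "(\<theta> / (1 + \<theta>)) ^ 2 \<le> 1 / 81" using assms(2) by linarith
  hence "(\<theta> / (1 + \<theta>)) ^ 2 * (a + c) ^ 3 \<le> 1 / 81 * (a + c) ^ 3"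
    using assms by (intro mult_right_mono) auto
  also have "\<dots> = (a + c) ^ 2 * (a + c) / 81" by (simp add: power2_eq_square power3_eq_cube)
  also have "\<dots> \<le> (3 * a) ^ 2 * (a + c) / 81"
    using assms False by (intro divide_right_mono mult_right_mono power_mono) auto
  also have "\<dots> = a ^ 2 * (a + c) / 9" by (simp add: power2_eq_square)
  also have "\<dots> \<le> a ^ 2 * (a + 4 * c) / 9"
    using assms by (intro divide_right_mono mult_left_mono) auto
  also have "\<dots> = a ^ 3 - 8 / 9 * (a ^ 2 * d)"
    by (simp add: d_def power2_eq_square power3_eq_cube field_simps)
  finally have "(\<theta> / (1 + \<theta>)) ^ 2 * (a + c) ^ 3 + 8 / 9 * (a ^ 2 * d) \<le> a ^ 3" by simp
  moreover have "0 \<le> \<theta> ^ 2 * c ^ 3" using assms by simp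
  ultimately show ?thesis using 1 by linarith
qed

text \<open>
  The bound on \<open>k\<close> ensures \<open>\<theta>^2 \<le> 3 / k \<le> 1 / 81\<close>, as \<open>local_deficit\<close> requires.  The set \<open>C\<close> has
  \<open>k T\<close> elements and \<open>A\<close> has about \<open>\<theta> k T\<close>, so that the unit weights are within \<open>O(1)\<close> of the optimal
  ratio of the two parts; since the deficit has a double root there, rounding costs \<open>O(t)\<close> only.
\<close>
lemma lagrangian_gap_3:
  fixes k :: nat
  assumes k: "k \<ge> 243"
  defines "\<theta> \<equiv> sqrt (3 * real k - 2) / real k"
  shows "lagrangian_gap 3 (1 - (\<theta> / (1 + \<theta>)) ^ 2)"
  unfolding lagrangian_gap_def
proof
  fix m
  define \<alpha> where "\<alpha> = 1 - (\<theta> / (1 + \<theta>)) ^ 2"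
  have k': "real k \<ge> 243" using k by simp
  have th2: "\<theta> ^ 2 = (3 * real k - 2) / real k ^ 2" using k' by (simp add: \<theta>_def power_divide)
  have th0: "\<theta> > 0" using k' by (simp add: \<theta>_def)
  have th81: "\<theta> ^ 2 \<le> 1 / 81"
  proof -
    have "243 * real k \<le> real k * real k" using k' by (intro mult_right_mono) auto
    hence "real k * 243 \<le> real k * real k + 162" by linarith
    thus ?thesis unfolding th2 using k' by (simp add: field_simps power2_eq_square)
  qed
  have th1: "\<theta> \<le> 1"
  proof -
    have "\<theta> ^ 2 \<le> 1 ^ 2" using th81 by simp
    thus ?thesis by (rule power2_le_imp_le) simp
  qed
  \<comment> \<open>The losses in the pattern with unit weights are \<open>6 t c + 3 (t + c)\<close> at most, where \<open>c\<close> is about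
    \<open>t / \<theta>\<close>; the \<open>6 D t^2\<close> gained from the triple system exceed them.\<close>
  define D where "D = 1 + 2 / \<theta>"
  obtain t0 where t0: "\<forall>A :: nat set. finite A \<and> card A \<ge> t0 \<longrightarrow>
     (\<exists>F \<subseteq> ksubsets A 3. D * real (card A) ^ 2 \<le> real (card F) \<and>
        (\<forall>S\<subseteq>A. S \<noteq> {} \<and> card S \<le> m \<longrightarrow> card {e \<in> F. e \<subseteq> S} \<le> card S - 1))"
    by (rule exE[OF ex_sparse_triple_system[of D m]])
  define T where "T = Suc t0"
  define c where "c = k * T"
  define t where "t = nat \<lceil>\<theta> * real c\<rceil>"
  have t_ge: "\<theta> * real c \<le> real t" and t_le: "real t \<le> \<theta> * real c + 1"
    using th0 by (auto simp: t_def le_of_int_ceiling of_nat_nat intro: ceiling_correct)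
  have "real T \<le> \<theta> * real c"
  proof -
    have "1 \<le> sqrt (3 * real k - 2)" using k' by simp
    hence "1 * real T \<le> sqrt (3 * real k - 2) * real T" by (intro mult_right_mono) auto
    also have "\<dots> = \<theta> * real c" using k' by (simp add: \<theta>_def c_def)
    finally show ?thesis by simp
  qed
  hence tT: "real T \<le> real t" using t_ge by linarith
  define C A where "C = {..<c}" and "A = {c..<c + t}"
  have fin: "finite A" "finite C" "A \<inter> C = {}" "card A = t" "card C = c"
    by (auto simp: A_def C_def)
  obtain F where F: "F \<subseteq> ksubsets A 3" "D * real t ^ 2 \<le> real (card F)"
    and sparse: "\<And>S. S \<subseteq> A \<Longrightarrow> S \<noteq> {} \<Longrightarrow> card S \<le> m \<Longrightarrow> card {e \<in> F. e \<subseteq> S} \<le> card S - 1"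
  proof -
    have "finite A \<and> card A \<ge> t0" using fin tT by (simp add: T_def)
    from t0[rule_format, OF this] show ?thesis using that unfolding fin(4) by blast
  qed
  \<comment> \<open>The classes of \<open>C\<close> are \<open>k\<close> consecutive intervals of length \<open>T\<close>.\<close>
  define \<tau> where "\<tau> x = x div T" for x
  define R where "R = {X. X \<subseteq> C \<and> card X = 3 \<and> \<tau> ` X \<in> ksubsets {..<k} 3}"
  have RC: "R \<subseteq> ksubsets C 3" by (auto simp: R_def ksubsets_def)
  define E where "E = ksubsets (A \<union> C) 3 - (ksubsets A 3 - F) - (ksubsets C 3 - R)"
  define z where "z y j = (\<Sum>x | x \<in> C \<and> \<tau> x = j. y x)" for y :: "nat \<Rightarrow> real" and j
  have R_poly: "edge_poly R y = edge_poly (ksubsets {..<k} 3) (z y)" for y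
    unfolding R_def z_def using fin by (intro edge_poly_blow_up) (auto simp: ksubsets_def card_ge_0_finite)
  have z_sum: "(\<Sum>j<k. z y j) = (\<Sum>x\<in>C. y x)" for y
    unfolding z_def using fin by (intro sum.group) (auto simp: C_def c_def \<tau>_def less_mult_imp_div_less)
  have UG: "uniform_graph 3 (A \<union> C) E"
    using fin by (auto simp: uniform_graph_def E_def ksubsets_def)
  have upper: "fact 3 * edge_poly E y \<le> \<alpha> * (\<Sum>v\<in>A \<union> C. y v) ^ 3"
    if y: "\<forall>v\<in>A \<union> C. 0 \<le> y v" "card {v \<in> A \<union> C. y v \<noteq> 0} \<le> m" for y
  proof -
    define a b where "a = (\<Sum>v\<in>A. y v)" and "b = (\<Sum>v\<in>C. y v)"
    define A' where "A' = {v \<in> A. y v \<noteq> 0}"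
    have b0: "b \<ge> 0" using y by (auto simp: b_def intro: sum_nonneg)
    have a0: "a \<ge> 0" using y by (auto simp: a_def intro: sum_nonneg)
    have z0: "z y j \<ge> 0" for j using y by (auto simp: z_def intro!: sum_nonneg)
    have Rle: "6 * edge_poly R y \<le> (1 - \<theta> ^ 2) * b ^ 3"
      using edge_poly_ksubsets_3_le[of "{..<k}" "z y"] k z0 by (simp add: R_poly z_sum th2 b_def)
    have "\<exists>M. 0 \<le> M \<and> M \<le> a \<and> M ^ 2 \<le> (\<Sum>v\<in>A. y v ^ 2) \<and> edge_poly F y \<le> M ^ 2 * (a - M)"
    proof (cases "A' = {}")
      case True
      have "(\<Prod>v\<in>e. y v) = 0" if e: "e \<in> F" for e
      proof -
        have e': "e \<subseteq> A" "card e = 3" using e F(1) by (auto simp: ksubsets_def)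
        then obtain v where "v \<in> e" by fastforce
        moreover have "finite e" using e' fin finite_subset by blast
        ultimately show ?thesis using True e' by (auto simp: A'_def prod_zero_iff)
      qed
      hence "edge_poly F y = 0" by (simp add: edge_poly_def)
      thus ?thesis using a0 by (intro exI[of _ 0]) (auto intro: sum_nonneg)
    next
      case False
      have finA': "finite A'" using fin by (simp add: A'_def)
      have "Max (y ` A') \<in> y ` A'" using False finA' by (intro Max_in) auto
      then obtain u where u: "u \<in> A'" "y u = Max (y ` A')" by auto
      have uA: "u \<in> A" using u by (auto simp: A'_def)
      \<comment> \<open>Sparseness is known for at most \<open>m\<close> vertices only, hence the restriction to the support.\<close>
      define F' where "F' = {e \<in> F. e \<subseteq> A'}"
      have cA': "card A' \<le> m"
      proof -
        have "card A' \<le> card {v \<in> A \<union> C. y v \<noteq> 0}" using fin by (intro card_mono) (auto simp: A'_def)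
        thus ?thesis using y by simp
      qed
      have "edge_poly F y = edge_poly F' y"
      proof -
        have "(\<Prod>v\<in>e. y v) = 0" if e: "e \<in> F - F'" for e
        proof -
          have e': "e \<subseteq> A" using e F(1) by (auto simp: ksubsets_def)
          moreover have "finite e" using e' fin finite_subset by blast
          moreover obtain v where "v \<in> e" "v \<notin> A'" using e by (auto simp: F'_def)
          ultimately show ?thesis by (auto simp: A'_def prod_zero_iff)
        qed
        moreover have "finite F" using F(1) fin finite_subset finite_ksubsets by blast
        ultimately show ?thesis unfolding edge_poly_def
          by (intro sum.mono_neutral_right) (auto simp: F'_def)
      qed
      also have "\<dots> \<le> y u ^ 2 * ((\<Sum>v\<in>A'. y v) - y u)"
      proof (rule edge_poly_sparse_le)
        show "\<And>e. e \<in> F' \<Longrightarrow> e \<subseteq> A' \<and> card e = 3" using F(1) by (auto simp: F'_def ksubsets_def)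
        show "\<And>v. v \<in> A' \<Longrightarrow> 0 \<le> y v \<and> y v \<le> y u" using y u finA' by (auto simp: A'_def)
        fix S assume S: "S \<subseteq> A'" "S \<noteq> {}"
        have "{e \<in> F'. e \<subseteq> S} = {e \<in> F. e \<subseteq> S}" using S by (auto simp: F'_def)
        moreover have "card S \<le> m" using card_mono[OF finA' S(1)] cA' by simp
        moreover have "S \<subseteq> A" using S by (auto simp: A'_def)
        ultimately show "card {e \<in> F'. e \<subseteq> S} \<le> card S - 1" using sparse S by simp
      qed (use finA' u in auto)
      also have "(\<Sum>v\<in>A'. y v) = a" unfolding a_def A'_def
        using fin by (intro sum.mono_neutral_left) auto
      finally have "edge_poly F y \<le> y u ^ 2 * (a - y u)" .
      moreover have "y u \<le> a" unfolding a_def using y fin uA by (intro member_le_sum) auto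
      moreover have "y u ^ 2 \<le> (\<Sum>v\<in>A. y v ^ 2)" using fin uA by (intro member_le_sum) auto
      ultimately show ?thesis using y uA by blast
    qed
    then obtain M where M: "0 \<le> M" "M \<le> a" "M ^ 2 \<le> (\<Sum>v\<in>A. y v ^ 2)"
      "edge_poly F y \<le> M ^ 2 * (a - M)" by blast
    have 1: "b * M ^ 2 \<le> b * (\<Sum>v\<in>A. y v ^ 2)" using M b0 by (intro mult_left_mono) auto
    have 2: "0 \<le> a * (\<Sum>v\<in>C. y v ^ 2)" using a0 by (intro mult_nonneg_nonneg sum_nonneg) auto
    have "6 * edge_poly E y = (a + b) ^ 3 - a ^ 3 - b ^ 3
     - 3 * (b * (\<Sum>v\<in>A. y v ^ 2) + a * (\<Sum>v\<in>C. y v ^ 2)) + 6 * edge_poly F y + 6 * edge_poly R y"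
      unfolding E_def a_def b_def by (rule edge_poly_join) (use fin F RC in auto)
    also have "\<dots> \<le> (a + b) ^ 3 - a ^ 3 - b ^ 3 - 3 * (b * M ^ 2)
        + 6 * (M ^ 2 * (a - M)) + (1 - \<theta> ^ 2) * b ^ 3"
      using 1 2 M(4) Rle by argo
    also have "\<dots> = (a + b) ^ 3 - (a ^ 3 + \<theta> ^ 2 * b ^ 3 + 3 * b * M ^ 2) + 6 * (M ^ 2 * (a - M))"
      by (simp add: algebra_simps)
    also have "\<dots> \<le> (a + b) ^ 3 - (\<theta> / (1 + \<theta>)) ^ 2 * (a + b) ^ 3"
      using local_deficit[OF th0 th81 M(1,2) b0] by linarith
    also have "\<dots> = \<alpha> * (a + b) ^ 3" by (simp add: \<alpha>_def algebra_simps)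
    also have "a + b = (\<Sum>v\<in>A \<union> C. y v)" unfolding a_def b_def
      using fin by (intro sum.union_disjoint[symmetric]) auto
    finally show ?thesis by (simp add: fact_numeral)
  qed
  have lower: "fact 3 * edge_poly E (\<lambda>v. real 1) > \<alpha> * (\<Sum>v\<in>A \<union> C. real 1) ^ 3"
  proof -
    define a b where "a = real t" and "b = real c"
    have a1: "a \<ge> 1" using tT by (simp add: a_def T_def)
    have "0 < k * T" using k by (simp add: T_def)
    hence b0: "b > 0" unfolding b_def c_def by (simp only: of_nat_0_less_iff)
    have zT: "z (\<lambda>_. 1) j = real T" if "j < k" for j
    proof -
      have "{x. x \<in> C \<and> \<tau> x = j} = {j * T..<Suc j * T}"
      proof (intro equalityI subsetI)
        fix x assume "x \<in> {x. x \<in> C \<and> \<tau> x = j}"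
        hence j: "x div T = j" by (simp add: \<tau>_def)
        have "j * T \<le> x" using div_times_less_eq_dividend[of x T] j by simp
        moreover have "x < T + j * T" using dividend_less_div_times[of T x] j by (simp add: T_def)
        ultimately show "x \<in> {j * T..<Suc j * T}" by simp
      next
        fix x assume x: "x \<in> {j * T..<Suc j * T}"
        hence "x div T = j" by (intro div_nat_eqI) (simp_all add: mult.commute)
        moreover have "Suc j * T \<le> k * T" using that by (intro mult_le_mono1) auto
        ultimately show "x \<in> {x. x \<in> C \<and> \<tau> x = j}" using x by (auto simp: C_def c_def \<tau>_def)
      qed
      thus ?thesis by (simp add: z_def)
    qed
    have bk: "b = real k * real T" by (simp add: b_def c_def)
    have "6 * edge_poly R (\<lambda>_. 1) = (\<Sum>j<k. z (\<lambda>_. 1) j) ^ 3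
       - 3 * (\<Sum>j<k. z (\<lambda>_. 1) j) * (\<Sum>j<k. z (\<lambda>_. 1) j ^ 2) + 2 * (\<Sum>j<k. z (\<lambda>_. 1) j ^ 3)"
      unfolding R_poly by (rule edge_poly_ksubsets_3) simp
    also have "\<dots> = b ^ 3 - 3 * b * (real k * real T ^ 2) + 2 * (real k * real T ^ 3)"
      by (simp add: zT bk)
    also have "\<dots> = (1 - \<theta> ^ 2) * b ^ 3"
      unfolding th2 bk using k' by (simp add: field_simps power2_eq_square power3_eq_cube)
    finally have R1: "6 * edge_poly R (\<lambda>_. 1) = (1 - \<theta> ^ 2) * b ^ 3" .
    have "6 * edge_poly E (\<lambda>_. 1) = (a + b) ^ 3 - a ^ 3 - b ^ 3 - 3 * (b * a + a * b)
        + 6 * real (card F) + 6 * edge_poly R (\<lambda>_. 1)"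
      using edge_poly_join[OF fin(1-3) F(1) RC, of "\<lambda>_. 1"] fin
      by (simp add: E_def[symmetric] a_def b_def card_eq_edge_poly)
    also have "\<dots> = (a + b) ^ 3 - (a ^ 3 + \<theta> ^ 2 * b ^ 3) - 6 * a * b + 6 * real (card F)"
      unfolding R1 by (simp add: algebra_simps)
    finally have E1: "6 * edge_poly E (\<lambda>_. 1) =
      (a + b) ^ 3 - (a ^ 3 + \<theta> ^ 2 * b ^ 3) - 6 * a * b + 6 * real (card F)" .
    have "(a - \<theta> * b) ^ 2 \<le> 1 ^ 2"
      using t_ge t_le by (intro power_mono) (auto simp: a_def b_def)
    moreover have "(1 + 2 * \<theta>) * a + (2 * \<theta> + \<theta> ^ 2) * b \<le> 3 * (a + b)"
    proof -
      have "(1 + 2 * \<theta>) * a \<le> 3 * a" using th1 a1 by (intro mult_right_mono) auto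
      moreover have "(2 * \<theta> + \<theta> ^ 2) * b \<le> 3 * b"
        using th1 th81 b0 by (intro mult_right_mono) auto
      ultimately show ?thesis by simp
    qed
    ultimately have "(a - \<theta> * b) ^ 2 * ((1 + 2 * \<theta>) * a + (2 * \<theta> + \<theta> ^ 2) * b) \<le> 1 ^ 2 * (3 * (a + b))"
      using th0 a1 b0 by (intro mult_mono) auto
    hence "(a - \<theta> * b) ^ 2 * ((1 + 2 * \<theta>) * a + (2 * \<theta> + \<theta> ^ 2) * b) / (1 + \<theta>) ^ 2 \<le> 3 * (a + b) / 1"
      using th0 a1 b0 by (intro frac_le) auto
    hence def: "a ^ 3 + \<theta> ^ 2 * b ^ 3 \<le> (\<theta> / (1 + \<theta>)) ^ 2 * (a + b) ^ 3 + 3 * (a + b)"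
      unfolding cubic_double_root[OF th0, of a b] by simp
    have ba: "b \<le> a / \<theta>" using t_ge th0 by (simp add: a_def b_def field_simps)
    have a2: "a \<le> a ^ 2" using a1 by (simp add: power2_eq_square)
    have ab: "6 * a * b \<le> 6 * (a ^ 2 / \<theta>)"
      using mult_left_mono[OF ba, of "6 * a"] a1 by (simp add: power2_eq_square mult_ac)
    have lin: "P + 3 * (a + b) < 6 * (Q + 2 * X)" if "b \<le> X" "P \<le> 6 * X" "a \<le> Q" for P Q X
      unfolding distrib_left using that a1 b0 by linarith
    have "b \<le> a ^ 2 / \<theta>" using ba divide_right_mono[OF a2, of \<theta>] th0 by simp
    hence "6 * a * b + 3 * (a + b) < 6 * (a ^ 2 + 2 * (a ^ 2 / \<theta>))"
      using ab a2 by (rule lin)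
    also have "\<dots> = 6 * (D * a ^ 2)" by (simp add: D_def algebra_simps)
    also have "\<dots> \<le> 6 * real (card F)" using F(2) by (simp add: a_def)
    finally have "(a + b) ^ 3 - (\<theta> / (1 + \<theta>)) ^ 2 * (a + b) ^ 3 < 6 * edge_poly E (\<lambda>_. 1)"
      unfolding E1 using def by linarith
    moreover have "real (card (A \<union> C)) = a + b"
      using fin by (simp add: card_Un_disjoint a_def b_def)
    ultimately show ?thesis by (simp add: fact_numeral \<alpha>_def algebra_simps)
  qed
  show "\<exists>(V :: nat set) E. uniform_graph 3 V E \<and>
     (\<exists>w :: nat \<Rightarrow> nat. fact 3 * edge_poly E (\<lambda>v. real (w v)) >
        (1 - (\<theta> / (1 + \<theta>)) ^ 2) * (\<Sum>v\<in>V. real (w v)) ^ 3) \<and>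
     (\<forall>y. (\<forall>v\<in>V. 0 \<le> y v) \<longrightarrow> card {v \<in> V. y v \<noteq> 0} \<le> m \<longrightarrow>
        fact 3 * edge_poly E y \<le> (1 - (\<theta> / (1 + \<theta>)) ^ 2) * (\<Sum>v\<in>V. y v) ^ 3)"
    unfolding \<alpha>_def[symmetric]
  proof (rule exI[of _ "A \<union> C"], rule exI[of _ E], intro conjI allI impI)
    show "\<exists>w :: nat \<Rightarrow> nat. fact 3 * edge_poly E (\<lambda>v. real (w v)) >
        \<alpha> * (\<Sum>v\<in>A \<union> C. real (w v)) ^ 3"
      using lower by (rule exI[of _ "\<lambda>_. 1"])
  qed (fact UG, rule upper)
qed

section \<open>Irrational non-jumps\<close>

lemma sqrt_Suc_square_irrational:
  fixes n :: nat
  assumes "n \<ge> 1"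
  shows "sqrt (real (n ^ 2 + 1)) \<notin> \<rat>"
proof
  assume "sqrt (real (n ^ 2 + 1)) \<in> \<rat>"
  then obtain p q :: nat where pq: "q \<noteq> 0" "\<bar>sqrt (real (n ^ 2 + 1))\<bar> = real p / real q" "coprime p q"
    by (rule Rats_abs_nat_div_natE)
  have "real (n ^ 2 + 1) = (real p / real q) ^ 2" unfolding pq(2)[symmetric] by simp
  hence "real ((n ^ 2 + 1) * q ^ 2) = real (p ^ 2)" using pq(1) by (simp add: field_simps)
  hence eq: "(n ^ 2 + 1) * q ^ 2 = p ^ 2" by (simp only: of_nat_eq_iff)
  hence "q ^ 2 dvd p ^ 2" by (metis dvd_triv_right)
  hence "q dvd p" by simp
  hence "q = 1" using pq(3) by (metis coprime_common_divisor_nat dvd_refl)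
  with eq have "n ^ 2 + 1 = p ^ 2" by simp
  moreover from this have "n < p" by (intro power_less_imp_less_base[of n 2 p]) auto
  hence "(n + 1) ^ 2 \<le> p ^ 2" by (intro power_mono) auto
  ultimately have "(n + 1) ^ 2 \<le> n ^ 2 + 1" by simp
  thus False using assms by (simp add: power2_eq_square)
qed

text \<open>
  The choice \<open>k = 3 i^2 + 1\<close> makes \<open>3 k - 2 = (3 i)^2 + 1\<close> a non-square.
\<close>
definition gap_value :: "nat \<Rightarrow> real" where
  "gap_value i = 1 - (let k = 3 * real i ^ 2 + 1; \<theta> = sqrt (3 * k - 2) / k in (\<theta> / (1 + \<theta>)) ^ 2)"

lemma gap_value_props:
  assumes "i \<ge> 9"
  shows "gap_value i \<notin> \<rat>" "0 \<le> gap_value i" "gap_value i < 1" "lagrangian_gap 3 (gap_value i)"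
proof -
  define k where "k = 3 * i ^ 2 + 1"
  have "9 ^ 2 \<le> i ^ 2" using assms by (intro power_mono) auto
  hence k: "k \<ge> 243" by (simp add: k_def)
  define \<theta> where "\<theta> = sqrt (3 * real k - 2) / real k"
  have gv: "gap_value i = 1 - (\<theta> / (1 + \<theta>)) ^ 2"
    by (simp add: gap_value_def Let_def \<theta>_def k_def add.commute)
  show "lagrangian_gap 3 (gap_value i)" unfolding gv \<theta>_def by (rule lagrangian_gap_3[OF k])
  have th: "\<theta> > 0" using k by (simp add: \<theta>_def)
  hence "0 < \<theta> / (1 + \<theta>)" "\<theta> / (1 + \<theta>) \<le> 1" by (auto simp: field_simps)
  hence "0 < (\<theta> / (1 + \<theta>)) ^ 2" "(\<theta> / (1 + \<theta>)) ^ 2 \<le> 1"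
    by (intro zero_less_power power_le_one; simp)+
  thus "0 \<le> gap_value i" "gap_value i < 1" by (simp_all add: gv)
  have irr: "\<theta> \<notin> \<rat>"
  proof
    assume "\<theta> \<in> \<rat>"
    hence "\<theta> * real k \<in> \<rat>" by simp
    also have "\<theta> * real k = sqrt (3 * real k - 2)" using k by (simp add: \<theta>_def)
    also have "3 * real k - 2 = real ((3 * i) ^ 2 + 1)" by (simp add: k_def power_mult_distrib)
    finally show False using sqrt_Suc_square_irrational[of "3 * i"] assms by simp
  qed
  have th2: "\<theta> ^ 2 \<in> \<rat>" using k by (simp add: \<theta>_def power_divide)
  show "gap_value i \<notin> \<rat>"
  proof
    assume "gap_value i \<in> \<rat>"
    hence "1 - gap_value i \<in> \<rat>" by simp
    hence \<rho>: "(\<theta> / (1 + \<theta>)) ^ 2 \<in> \<rat>" by (simp add: gv)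
    \<comment> \<open>Both \<open>\<theta>^2\<close> and \<open>(1 + \<theta>)^2\<close> would be rational, hence also \<open>\<theta>\<close>.\<close>
    have "\<theta> ^ 2 / (\<theta> / (1 + \<theta>)) ^ 2 = (1 + \<theta>) ^ 2" using th by (simp add: power_divide)
    hence "(\<theta> ^ 2 / (\<theta> / (1 + \<theta>)) ^ 2 - 1 - \<theta> ^ 2) / 2 = \<theta>"
      by (simp add: power2_eq_square algebra_simps)
    moreover have "(\<theta> ^ 2 / (\<theta> / (1 + \<theta>)) ^ 2 - 1 - \<theta> ^ 2) / 2 \<in> \<rat>"
      using \<rho> th2 by (intro Rats_divide Rats_diff) auto
    ultimately show False using irr by simp
  qed
qed

lemma gap_value_inj: "inj_on gap_value {9..}"
proof (rule inj_onI)
  fix i j :: nat assume ij: "i \<in> {9..}" "j \<in> {9..}" and eq: "gap_value i = gap_value j"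
  define k l where "k = 3 * real i ^ 2 + 1" and "l = 3 * real j ^ 2 + 1"
  define \<theta> \<eta> where "\<theta> = sqrt (3 * k - 2) / k" and "\<eta> = sqrt (3 * l - 2) / l"
  have "9 ^ 2 \<le> real i ^ 2" "9 ^ 2 \<le> real j ^ 2" using ij by (intro power_mono; simp)+
  hence kl: "k \<ge> 4" "l \<ge> 4" by (auto simp: k_def l_def)
  have th: "\<theta> > 0" "\<eta> > 0" using kl by (auto simp: \<theta>_def \<eta>_def)
  have "(\<theta> / (1 + \<theta>)) ^ 2 = (\<eta> / (1 + \<eta>)) ^ 2"
    using eq by (simp add: gap_value_def Let_def \<theta>_def \<eta>_def k_def l_def)
  hence "\<theta> / (1 + \<theta>) = \<eta> / (1 + \<eta>)" using th by (subst (asm) power2_eq_iff_nonneg) auto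
  hence "\<theta> = \<eta>" using th by (simp add: field_simps)
  hence "\<theta> ^ 2 = \<eta> ^ 2" by simp
  hence "(3 * k - 2) / k ^ 2 = (3 * l - 2) / l ^ 2" using kl by (simp add: \<theta>_def \<eta>_def power_divide)
  hence "(3 * k - 2) * l ^ 2 = (3 * l - 2) * k ^ 2" using kl by (simp add: field_simps)
  hence "(l - k) * (3 * k * l - 2 * (k + l)) = 0" by (simp add: power2_eq_square algebra_simps)
  moreover have "3 * k * l - 2 * (k + l) > 0"
  proof -
    have "4 * l \<le> k * l" "4 * k \<le> k * l" using kl mult_right_mono[of 4 k l] mult_right_mono[of 4 l k] by (auto simp: mult.commute)
    moreover have "0 < k * l" using kl by (intro mult_pos_pos) auto
    ultimately have "0 < (k * l - 4 * l) + (k * l - 4 * k) + 4 * (k * l)" by linarith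
    also have "\<dots> = 2 * (3 * k * l - 2 * (k + l))" by (simp add: algebra_simps)
    finally show ?thesis by simp
  qed
  ultimately have "k = l" by simp
  hence "real i ^ 2 = real j ^ 2" by (simp add: k_def l_def)
  thus "i = j" by simp
qed

lemma infinite_irrational_gap:
  "r \<ge> 3 \<Longrightarrow> infinite {\<alpha>. \<alpha> \<notin> \<rat> \<and> 0 \<le> \<alpha> \<and> \<alpha> < 1 \<and> lagrangian_gap r \<alpha>}"
proof (induction r rule: nat_induct_at_least)
  case base
  have "infinite (gap_value ` {9..})"
    using gap_value_inj finite_imageD infinite_Ici by blast
  moreover have "gap_value ` {9..} \<subseteq> {\<alpha>. \<alpha> \<notin> \<rat> \<and> 0 \<le> \<alpha> \<and> \<alpha> < 1 \<and> lagrangian_gap 3 \<alpha>}"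
    using gap_value_props by auto
  ultimately show ?case using finite_subset by blast
next
  case (Suc r)
  define q where "q = (real r / (real r + 1)) ^ r"
  have q: "0 < q" "q \<le> 1" "q \<in> \<rat>"
    using Suc.hyps by (auto simp: q_def intro!: zero_less_power power_le_one)
  let ?S = "{\<alpha>. \<alpha> \<notin> \<rat> \<and> 0 \<le> \<alpha> \<and> \<alpha> < 1 \<and> lagrangian_gap r \<alpha>}"
  have "inj_on (\<lambda>\<alpha>. \<alpha> * q) ?S" using q by (intro inj_onI) auto
  hence "infinite ((\<lambda>\<alpha>. \<alpha> * q) ` ?S)" using Suc.IH finite_imageD by blast
  moreover have "(\<lambda>\<alpha>. \<alpha> * q) ` ?S \<subseteq> {\<alpha>. \<alpha> \<notin> \<rat> \<and> 0 \<le> \<alpha> \<and> \<alpha> < 1 \<and> lagrangian_gap (Suc r) \<alpha>}"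
  proof clarify
    fix \<alpha> assume a: "\<alpha> \<notin> \<rat>" "0 \<le> \<alpha>" "\<alpha> < 1" "lagrangian_gap r \<alpha>"
    have "\<alpha> * q \<notin> \<rat>"
    proof
      assume "\<alpha> * q \<in> \<rat>"
      hence "\<alpha> * q / q \<in> \<rat>" using q by (intro Rats_divide) auto
      thus False using a q by simp
    qed
    moreover have "\<alpha> * q < 1" using a q mult_left_le[of q \<alpha>] by linarith
    moreover have "lagrangian_gap (Suc r) (\<alpha> * q)"
      unfolding q_def using a Suc.hyps by (intro lagrangian_gap_Suc) auto
    ultimately show "\<alpha> * q \<notin> \<rat> \<and> 0 \<le> \<alpha> * q \<and> \<alpha> * q < 1 \<and> lagrangian_gap (Suc r) (\<alpha> * q)"
      using a q by simp
  qed
  ultimately show ?case using finite_subset by blast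
qed

theorem mainTheorem4:
  fixes r :: nat
  assumes "r \<ge> 3"
  shows "infinite {\<alpha> :: real. \<alpha> \<notin> \<rat> \<and> non_jump r \<alpha>}"
proof -
  have "{\<alpha>. \<alpha> \<notin> \<rat> \<and> 0 \<le> \<alpha> \<and> \<alpha> < 1 \<and> lagrangian_gap r \<alpha>} \<subseteq> {\<alpha>. \<alpha> \<notin> \<rat> \<and> non_jump r \<alpha>}"
    using lagrangian_gap_imp_non_jump assms by auto
  thus ?thesis using infinite_irrational_gap[OF assms] finite_subset by blast
qed

end
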